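(* Let $k>0$. Let $D$ be the region enclosed by the curve $$x(t)=(2+\cos2t)(\cos t,\sin t),\qquad t\in[-\pi,\pi],$$ having a constant refractive index $0<q\neq1$. Let $u^{\mathrm{in}}$ be an incident wave with wave number $k$ that is a finite linear combination of plane waves or a Herglotz wave, such that $$u^{\mathrm{in}}(x(t_0))\neq0,\qquad t_0=\frac i2\ln(2+\sqrt7).$$ Then $u^{\mathrm{in}}$ is scattered by $D$.
   Context: A plane wave is $e^{ikx\cdot\eta}$ with $\eta\in\mathbb R^2$ a unit vector. A Herglotz wave is $\int_{\mathbb S^1}\psi(\eta)e^{ikx\cdot\eta}\,ds(\eta)$ with $\psi\in L^2(\mathbb S^1)$, where $\mathbb S^1$ is the unit circle centered at the origin. Both extend to entire functions of $x\in\mathbb C^2$ (with $x\cdot\eta=x_1\eta_1+x_2\eta_2$), and $u^{\mathrm{in}}(x(t_0))$ refers to this extension evaluated at the point $x(t_0)\in\mathbb C^2$ given by the entire extension of $x(t)$. An incident wave with wave number $k>0$ is a non-trivial solution $u^{\mathrm{in}}$ of $\Delta u^{\mathrm{in}}+k^2u^{\mathrm{in}}=0$ in $\mathbb R^2$. For a bounded simply connected planar domain $D$ with constant refractive index $q$ (the index is $1$ outside $D$), $u^{\mathrm{in}}$ is called nonscattering for $D$ if there is $u\in H^2_{\mathrm{loc}}(\mathbb R^2)$ with $u=0$ in $\mathbb R^2\setminus D$ and $\Delta u+k^2qu=k^2(1-q)u^{\mathrm{in}}\chi_D$ in $\mathbb R^2$, where $\chi_D$ is the indicator function of $D$ (here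 $u$ is the total field minus $u^{\mathrm{in}}$). Otherwise $u^{\mathrm{in}}$ is said to be scattered by $D$. *)

theory Defs
  imports "HOL-Analysis.Analysis"
begin

definition partial_deriv :: "2 \<Rightarrow> (real^2 \<Rightarrow> complex) \<Rightarrow> real^2 \<Rightarrow> complex" where
  "partial_deriv i f x = frechet_derivative f (at x) (axis i 1)"

definition laplacian :: "(real^2 \<Rightarrow> complex) \<Rightarrow> real^2 \<Rightarrow> complex" where
  "laplacian f x = (\<Sum>i\<in>UNIV. partial_deriv i (partial_deriv i f) x)"

fun C_k :: "nat \<Rightarrow> (real^2 \<Rightarrow> complex) \<Rightarrow> bool" where
  "C_k 0 f \<longleftrightarrow> continuous_on UNIV f"
| "C_k (Suc n) f \<longleftrightarrow> (\<forall>x. f differentiable (at x)) \<and> (\<forall>i. C_k n (partial_deriv i f))"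

definition test_function :: "(real^2 \<Rightarrow> complex) \<Rightarrow> bool" where
  "test_function \<phi> \<longleftrightarrow> (\<forall>n. C_k n \<phi>) \<and> (\<exists>K. compact K \<and> (\<forall>x. x \<notin> K \<longrightarrow> \<phi> x = 0))"

definition loc_integrable :: "(real^2 \<Rightarrow> complex) \<Rightarrow> bool" where
  "loc_integrable f \<longleftrightarrow> (\<forall>K. compact K \<longrightarrow> set_integrable lebesgue K f)"

definition L2_loc :: "(real^2 \<Rightarrow> complex) \<Rightarrow> bool" where
  "L2_loc f \<longleftrightarrow> f \<in> borel_measurable lebesgue \<and>
     (\<forall>K. compact K \<longrightarrow> set_integrable lebesgue K (\<lambda>x. (cmod (f x))\<^sup>2))"

text \<open>Relational, since a weak derivative is determined only up to null sets.\<close>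

definition weak_pderiv :: "2 \<Rightarrow> (real^2 \<Rightarrow> complex) \<Rightarrow> (real^2 \<Rightarrow> complex) \<Rightarrow> bool" where
  "weak_pderiv i f g \<longleftrightarrow> loc_integrable f \<and> loc_integrable g \<and>
     (\<forall>\<phi>. test_function \<phi> \<longrightarrow>
        (LINT x|lebesgue. f x * partial_deriv i \<phi> x) = - (LINT x|lebesgue. g x * \<phi> x))"

definition weak_laplacian :: "(real^2 \<Rightarrow> complex) \<Rightarrow> (real^2 \<Rightarrow> complex) \<Rightarrow> bool" where
  "weak_laplacian f L \<longleftrightarrow> (\<exists>g h. (\<forall>i. weak_pderiv i f (g i) \<and> weak_pderiv i (g i) (h i)) \<and>
     L = (\<lambda>x. \<Sum>i\<in>UNIV. h i x))"

text \<open>\<open>H_loc m\<close> is the space of functions all of whose weak derivatives of order at most \<open>m\<close>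
  exist and are locally square integrable.\<close>

fun H_loc :: "nat \<Rightarrow> (real^2 \<Rightarrow> complex) \<Rightarrow> bool" where
  "H_loc 0 f \<longleftrightarrow> L2_loc f"
| "H_loc (Suc m) f \<longleftrightarrow> L2_loc f \<and> (\<forall>i. \<exists>g. weak_pderiv i f g \<and> H_loc m g)"

definition incident_wave :: "real \<Rightarrow> (real^2 \<Rightarrow> complex) \<Rightarrow> bool" where
  "incident_wave k u \<longleftrightarrow> C_k 2 u \<and> (\<forall>x. laplacian u x + of_real (k\<^sup>2) * u x = 0) \<and> (\<exists>x. u x \<noteq> 0)"

text \<open>The function \<open>u\<close> below is the total field minus the incident field. Being an element of a
  Sobolev space, it satisfies its two conditions almost everywhere.\<close>

definition nonscattering :: "real \<Rightarrow> real \<Rightarrow> (real^2) set \<Rightarrow> (real^2 \<Rightarrow> complex) \<Rightarrow> bool" where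
  "nonscattering k q D u_in \<longleftrightarrow>
     (\<exists>u L. H_loc 2 u \<and> weak_laplacian u L \<and>
        (AE x in lebesgue. x \<notin> D \<longrightarrow> u x = 0) \<and>
        (AE x in lebesgue. L x + of_real (k\<^sup>2 * q) * u x
            = of_real (k\<^sup>2 * (1 - q)) * u_in x * indicator D x))"

definition scattered :: "real \<Rightarrow> real \<Rightarrow> (real^2) set \<Rightarrow> (real^2 \<Rightarrow> complex) \<Rightarrow> bool" where
  "scattered k q D u_in \<longleftrightarrow> \<not> nonscattering k q D u_in"

text \<open>The waves are given directly as entire functions on \<open>\<complex>\<^sup>2\<close>; the waves on the plane are
  their restrictions along \<open>cvec\<close>. The product \<open>z \<cdot> \<eta>\<close> is bilinear, without conjugation.\<close>

definition cvec :: "real^2 \<Rightarrow> complex^2" where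
  "cvec x = (\<chi> j. of_real (x $ j))"

definition plane_wave :: "real \<Rightarrow> real^2 \<Rightarrow> complex^2 \<Rightarrow> complex" where
  "plane_wave k \<eta> z = exp (\<i> * of_real k * (z $ 1 * of_real (\<eta> $ 1) + z $ 2 * of_real (\<eta> $ 2)))"

definition plane_wave_combination :: "real \<Rightarrow> (complex^2 \<Rightarrow> complex) \<Rightarrow> bool" where
  "plane_wave_combination k U \<longleftrightarrow>
     (\<exists>S c. finite S \<and> (\<forall>\<eta>\<in>S. norm \<eta> = 1) \<and> U = (\<lambda>z. \<Sum>\<eta>\<in>S. c \<eta> * plane_wave k \<eta> z))"

text \<open>Arc length on the unit circle, as a Borel measure on the plane. Every class in
  \<open>L\<^sup>2\<close> of the circle has a Borel representative.\<close>

definition circle_measure :: "(real^2) measure" where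
  "circle_measure = distr (restrict_space lborel {-pi..pi}) borel (\<lambda>\<theta>. vector [cos \<theta>, sin \<theta>])"

definition herglotz_wave :: "real \<Rightarrow> (complex^2 \<Rightarrow> complex) \<Rightarrow> bool" where
  "herglotz_wave k U \<longleftrightarrow>
     (\<exists>\<psi>. \<psi> \<in> borel_measurable circle_measure \<and> integrable circle_measure (\<lambda>\<eta>. (cmod (\<psi> \<eta>))\<^sup>2) \<and>
        U = (\<lambda>z. LINT \<eta>|circle_measure. \<psi> \<eta> * plane_wave k \<eta> z))"

text \<open>At type \<open>real\<close> this is the boundary curve, at type \<open>complex\<close> its entire extension.\<close>

definition curve :: "'a \<Rightarrow> ('a::{real_normed_field,banach})^2" where
  "curve t = vector [(2 + cos (2 * t)) * cos t, (2 + cos (2 * t)) * sin t]"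

definition region :: "(real^2) set" where
  "region = inside (curve ` {-pi..pi})"

end

theory Submission
  imports Defs "HOL-Probability.Probability" "HOL-Complex_Analysis.Complex_Analysis"
    "HOL-Real_Asymp.Real_Asymp"
begin

text \<open>If \<open>u\<^sup>i\<^sup>n\<close> did not scatter, testing the equation for \<open>u\<close> with solutions \<open>v\<close> of
  \<open>\<Delta>v + k\<^sup>2 q v = 0\<close> would give \<open>\<integral>\<^sub>D u\<^sup>i\<^sup>n v = 0\<close>. In the characteristic coordinates
  \<open>z = x\<^sub>1 + \<i> x\<^sub>2\<close>, \<open>w = x\<^sub>1 - \<i> x\<^sub>2\<close> take \<open>v = exp (n z + \<mu> w)\<close> with \<open>4 n \<mu> = - k\<^sup>2 q\<close> and let
  \<open>n\<close> tend to infinity. For each plane wave in the superposition \<open>u\<^sup>i\<^sup>n\<close>, integrating over \<open>D\<close> in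
  \<open>x\<^sub>2\<close> first turns the area integral into the integral of an entire \<open>2 \<pi>\<close>-periodic function of
  \<open>t\<close>, whose contour can be moved to the horizontal line through \<open>t\<^sub>0\<close>. There \<open>z(t)\<close> is a combination
  of \<open>e\<^sup>i\<^sup>s\<close>, \<open>e\<^sup>3\<^sup>i\<^sup>s\<close>, \<open>e\<^sup>-\<^sup>i\<^sup>s\<close> (\<open>s = Re t\<close>) with positive coefficients, so \<open>Re z\<close> is maximal
  exactly at \<open>t\<^sub>0\<close>, which is a nondegenerate critical point of \<open>z\<close>. Laplace's method makes the
  rescaled integrals converge to a nonzero multiple of \<open>u\<^sup>i\<^sup>n(x(t\<^sub>0))\<close>, which must therefore vanish.\<close>

unbundle no fps_syntax

section \<open>Smooth functions on the plane\<close>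

lemma partial_deriv_eqI: "(f has_derivative f') (at x) \<Longrightarrow> partial_deriv i f x = f' (axis i 1)"
  unfolding partial_deriv_def by (metis frechet_derivative_at)

lemma has_derivative_frechet: "f differentiable (at x) \<Longrightarrow> (f has_derivative frechet_derivative f (at x)) (at x)"
  by (simp add: frechet_derivative_works)

lemma partial_deriv_cong_open:
  assumes "open S" "x \<in> S" "\<And>y. y \<in> S \<Longrightarrow> f y = g y" "g differentiable (at x)"
  shows "partial_deriv i f x = partial_deriv i g x"
proof -
  have "(f has_derivative frechet_derivative g (at x)) (at x)"
    by (rule has_derivative_transform_within_open[OF has_derivative_frechet[OF assms(4)] assms(1,2)])
      (simp add: assms(3))
  then show ?thesis
    unfolding partial_deriv_def by (metis frechet_derivative_at)
qed

lemma C_k_imp_continuous: "C_k n f \<Longrightarrow> continuous_on UNIV f"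
  by (cases n) (auto simp: differentiable_imp_continuous_within continuous_on_eq_continuous_at)

lemma C_k_Suc_imp: "C_k (Suc n) f \<Longrightarrow> C_k n f"
proof (induction n arbitrary: f)
  case 0
  then show ?case using C_k_imp_continuous by (metis C_k.simps(1))
next
  case (Suc n)
  then show ?case by (metis C_k.simps(2))
qed

lemma partial_deriv_add:
  assumes "f differentiable (at x)" "g differentiable (at x)"
  shows "partial_deriv i (\<lambda>x. f x + g x) x = partial_deriv i f x + partial_deriv i g x"
  using partial_deriv_eqI[OF has_derivative_add[OF has_derivative_frechet[OF assms(1)] has_derivative_frechet[OF assms(2)]]]
  by (simp add: partial_deriv_def)

lemma partial_deriv_mult:
  assumes "f differentiable (at x)" "g differentiable (at x)"
  shows "partial_deriv i (\<lambda>x. f x * g x) x = f x * partial_deriv i g x + partial_deriv i f x * g x"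
  using partial_deriv_eqI[OF has_derivative_mult[OF has_derivative_frechet[OF assms(1)] has_derivative_frechet[OF assms(2)]]]
  by (simp add: partial_deriv_def)

lemma C_k_add: "C_k n f \<Longrightarrow> C_k n g \<Longrightarrow> C_k n (\<lambda>x. f x + g x)"
proof (induction n arbitrary: f g)
  case 0
  then show ?case by (simp add: continuous_on_add)
next
  case (Suc n)
  have "partial_deriv i (\<lambda>x. f x + g x) = (\<lambda>x. partial_deriv i f x + partial_deriv i g x)" for i
    using Suc.prems by (auto simp: partial_deriv_add)
  with Suc show ?case by auto
qed

lemma C_k_mult: "C_k n f \<Longrightarrow> C_k n g \<Longrightarrow> C_k n (\<lambda>x. f x * g x)"
proof (induction n arbitrary: f g)
  case 0
  then show ?case by (simp add: continuous_on_mult)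
next
  case (Suc n)
  have "partial_deriv i (\<lambda>x. f x * g x) = (\<lambda>x. f x * partial_deriv i g x + partial_deriv i f x * g x)" for i
    using Suc.prems by (auto simp: partial_deriv_mult)
  moreover have "C_k n f" "C_k n g" using Suc.prems C_k_Suc_imp by blast+
  ultimately show ?case using Suc by (auto intro!: C_k_add)
qed

lemma partial_deriv_const: "partial_deriv i (\<lambda>x. c) = (\<lambda>x. 0)"
  by (auto intro!: ext partial_deriv_eqI derivative_eq_intros)

lemma C_k_const: "C_k n (\<lambda>x. c)"
  by (induction n arbitrary: c) (auto simp: partial_deriv_const)

lemma bounded_linear_vec_nth_of_real: "bounded_linear (\<lambda>x::real^2. complex_of_real (x $ i))"
  by (rule bounded_linear_compose[OF bounded_linear_of_real bounded_linear_vec_nth])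

lemma has_derivative_coord:
  "((\<lambda>x::real^2. complex_of_real (x $ i)) has_derivative (\<lambda>h. of_real (h $ i))) F"
  using bounded_linear_imp_has_derivative[OF bounded_linear_vec_nth_of_real] .

lemma C_k_coord: "C_k n (\<lambda>x. complex_of_real (x $ i))"
proof (cases n)
  case 0
  then show ?thesis by (auto intro!: continuous_intros)
next
  case (Suc m)
  have "partial_deriv j (\<lambda>x. complex_of_real (x $ i)) = (\<lambda>x. of_real (axis j 1 $ i))" for j
    by (rule ext, rule partial_deriv_eqI, rule has_derivative_coord)
  then show ?thesis using Suc
    by (auto simp: C_k_const differentiable_def intro: has_derivative_coord)
qed

text \<open>\<open>C_k\<close> speaks of complex-valued functions, so the real function
  \<open>g\<close> enters through its embedding. Supplying all derivatives of the outer function as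
  one sequence \<open>F\<close> lets the chain rule, which turns \<open>F j\<close> into
  \<open>F (Suc j)\<close>, close under induction on \<open>n\<close> with \<open>j\<close>
  arbitrary.\<close>

lemma C_k_compose_real:
  fixes F :: "nat \<Rightarrow> real \<Rightarrow> real" and g :: "real^2 \<Rightarrow> real"
  assumes F: "\<And>j t. (F j has_field_derivative F (Suc j) t) (at t)"
    and g: "\<And>n. C_k n (\<lambda>x. complex_of_real (g x))"
  shows "C_k n (\<lambda>x. complex_of_real (F j (g x)))"
proof (induction n arbitrary: j)
  have gd: "(g has_derivative (\<lambda>h. Re (frechet_derivative (\<lambda>x. complex_of_real (g x)) (at x) h))) (at x)" for x
  proof -
    have "((\<lambda>x. complex_of_real (g x)) has_derivative frechet_derivative (\<lambda>x. complex_of_real (g x)) (at x)) (at x)"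
      using g[of 1] by (intro has_derivative_frechet) auto
    from has_derivative_Re[OF this] show ?thesis by simp
  qed
  \<comment> \<open>The embedded function has imaginary part 0 everywhere, so its derivative is
    real-valued and can be identified with that of \<open>g\<close>.\<close>
  have im: "Im (frechet_derivative (\<lambda>x. complex_of_real (g x)) (at x) h) = 0" for x h
  proof -
    have "((\<lambda>x. complex_of_real (g x)) has_derivative frechet_derivative (\<lambda>x. complex_of_real (g x)) (at x)) (at x)"
      using g[of 1] by (intro has_derivative_frechet) auto
    from has_derivative_Im[OF this] have "((\<lambda>x. 0) has_derivative (\<lambda>h. Im (frechet_derivative (\<lambda>x. complex_of_real (g x)) (at x) h))) (at x)"
      by simp
    from has_derivative_unique[OF this has_derivative_const] show ?thesis by meson
  qed
  have d: "((\<lambda>x. complex_of_real (F j (g x))) has_derivative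
      (\<lambda>h. complex_of_real (F (Suc j) (g x)) * frechet_derivative (\<lambda>x. complex_of_real (g x)) (at x) h)) (at x)" for j x
  proof -
    have "((\<lambda>x. F j (g x)) has_derivative (\<lambda>h. Re (frechet_derivative (\<lambda>x. complex_of_real (g x)) (at x) h) * F (Suc j) (g x))) (at x)"
      by (rule DERIV_compose_FDERIV[OF F gd])
    from bounded_linear.has_derivative[OF bounded_linear_of_real this]
    show ?thesis
      by (rule has_derivative_eq_rhs) (auto simp: complex_eq_iff im)
  qed
  {
    case 0
    show ?case using has_derivative_continuous[OF d]
      unfolding C_k.simps continuous_on_eq_continuous_at[OF open_UNIV] by blast
  next
    case (Suc n)
    have "partial_deriv i (\<lambda>x. complex_of_real (F j (g x))) =
      (\<lambda>x. complex_of_real (F (Suc j) (g x)) * partial_deriv i (\<lambda>x. complex_of_real (g x)) x)" for i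
      by (rule ext) (simp add: partial_deriv_eqI[OF d] partial_deriv_def)
    moreover have "C_k n (partial_deriv i (\<lambda>x. complex_of_real (g x)))" for i
      using g[of "Suc n"] by simp
    moreover have "(\<lambda>x. complex_of_real (F j (g x))) differentiable (at x)" for x
      using d by (rule differentiableI)
    ultimately show ?case
      using Suc.IH by (auto intro!: C_k_mult)
  }
qed

section \<open>Exponential functions with complex exponents, covering plane waves and growing
  solutions alike\<close>

definition exp_wave :: "complex \<Rightarrow> complex \<Rightarrow> real^2 \<Rightarrow> complex" where
  "exp_wave A B x = exp (A * of_real (x $ 1) + B * of_real (x $ 2))"

lemma has_derivative_exp_wave:
  "(exp_wave A B has_derivative (\<lambda>h. exp_wave A B x * (A * of_real (h $ 1) + B * of_real (h $ 2)))) (at x)"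
proof -
  have "((\<lambda>x. A * of_real (x $ 1) + B * of_real (x $ 2)) has_derivative (\<lambda>h. A * of_real (h $ 1) + B * of_real (h $ 2))) (at x)"
    by (intro derivative_intros has_derivative_coord)
  from has_derivative_compose[OF this DERIV_exp[unfolded has_field_derivative_def]]
  show ?thesis
    unfolding exp_wave_def[abs_def] .
qed

lemma partial_deriv_exp_wave:
  "partial_deriv i (exp_wave A B) = (\<lambda>x. (if i = 1 then A else B) * exp_wave A B x)"
proof
  fix x
  show "partial_deriv i (exp_wave A B) x = (if i = 1 then A else B) * exp_wave A B x"
    using exhaust_2[of i] by (auto simp: partial_deriv_eqI[OF has_derivative_exp_wave] axis_def)
qed

lemma C_k_exp_wave: "C_k n (exp_wave A B)"
proof (induction n)
  case 0
  show ?case by (auto simp: exp_wave_def[abs_def] intro!: continuous_intros)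
next
  case (Suc n)
  then show ?case
    by (auto simp: partial_deriv_exp_wave differentiable_def intro!: C_k_mult C_k_const has_derivative_exp_wave)
qed

lemma laplacian_exp_wave: "laplacian (exp_wave A B) x = (A\<^sup>2 + B\<^sup>2) * exp_wave A B x"
proof -
  have *: "partial_deriv i (\<lambda>x. c * exp_wave A B x) x = c * partial_deriv i (exp_wave A B) x" for i c
    using C_k_exp_wave[of 1 A B]
    by (subst partial_deriv_mult) (auto simp: partial_deriv_const)
  show ?thesis
    unfolding laplacian_def partial_deriv_exp_wave sum_2 *
    by (simp add: power2_eq_square algebra_simps)
qed

section \<open>The flat function exp (-1/t) and smooth cutoffs\<close>

lemma poly_over_exp_tendsto_0: "((\<lambda>y::real. poly p y / exp y) \<longlongrightarrow> 0) at_top"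
proof -
  have "((\<lambda>y. \<Sum>i\<le>degree p. coeff p i * (y ^ i / exp y)) \<longlongrightarrow> (\<Sum>i\<le>degree p. coeff p i * 0)) at_top"
    by (intro tendsto_intros tendsto_power_div_exp_0)
  then show ?thesis by (simp add: poly_altdef sum_divide_distrib)
qed

text \<open>Carrying a polynomial in 1/t makes this family closed under differentiation, so
  smoothness of exp (-1/t) follows from a statement about first derivatives only.\<close>

definition flat :: "real poly \<Rightarrow> real \<Rightarrow> real" where
  "flat p t = (if t > 0 then poly p (1 / t) * exp (- (1 / t)) else 0)"

text \<open>With y = 1/t, the derivative in t of p(y) exp (-y) is y^2 (p(y) - p'(y)) exp
  (-y).\<close>

definition flat_step :: "real poly \<Rightarrow> real poly" where
  "flat_step p = [:0, 0, 1:] * (p - pderiv p)"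

lemma DERIV_flat: "(flat p has_field_derivative flat (flat_step p) t) (at t)"
proof -
  consider "t > 0" | "t < 0" | "t = 0" by linarith
  then show ?thesis
  proof cases
    case 1
    have "((\<lambda>t. poly p (1 / t) * exp (- (1 / t))) has_field_derivative flat (flat_step p) t) (at t)"
      using 1 by (auto intro!: derivative_eq_intros DERIV_chain2[OF poly_DERIV]
          simp: flat_def flat_step_def field_simps power2_eq_square)
    then show ?thesis
      by (rule has_field_derivative_transform_within_open[where S = "{0<..}"])
        (use 1 in \<open>auto simp: flat_def\<close>)
  next
    case 2
    have "((\<lambda>t. 0) has_field_derivative flat (flat_step p) t) (at t)"
      using 2 by (auto simp: flat_def)
    then show ?thesis
      by (rule has_field_derivative_transform_within_open[where S = "{..<0}"])
        (use 2 in \<open>auto simp: flat_def\<close>)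
  next
    case 3
    have "((\<lambda>h. flat p h / h) \<longlongrightarrow> 0) (at_right 0)"
    proof -
      \<comment> \<open>Under h = 1/y the right difference quotient at 0 becomes y p(y) / exp y, and
        \<open>pCons 0 p\<close> is the polynomial y p(y).\<close>
      have "((\<lambda>y. poly (pCons 0 p) y / exp y) \<longlongrightarrow> 0) at_top"
        by (rule poly_over_exp_tendsto_0)
      then have "((\<lambda>y. flat p (inverse y) / inverse y) \<longlongrightarrow> 0) at_top"
      proof (rule Lim_transform_eventually)
        show "\<forall>\<^sub>F y in at_top. poly (pCons 0 p) y / exp y = flat p (inverse y) / inverse y"
          using eventually_gt_at_top[of "0::real"]
          by eventually_elim (simp add: flat_def exp_minus field_simps)
      qed
      then show ?thesis
        by (simp add: filterlim_at_right_to_top)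
    qed
    moreover have "((\<lambda>h. flat p h / h) \<longlongrightarrow> 0) (at_left 0)"
      by (rule Lim_transform_eventually[OF tendsto_const])
        (auto simp: eventually_at_left_field flat_def intro!: exI[of _ "-1"])
    ultimately have "((\<lambda>h. flat p h / h) \<longlongrightarrow> 0) (at 0)"
      using filterlim_split_at by blast
    then show ?thesis
      using 3 by (simp add: has_field_derivative_iff flat_def)
  qed
qed

lemma C_k_flat:
  assumes "\<And>n. C_k n (\<lambda>x. complex_of_real (g x))"
  shows "C_k n (\<lambda>x. complex_of_real (flat p (g x)))"
  using C_k_compose_real[of "\<lambda>j. flat ((flat_step ^^ j) p)" g n 0] assms DERIV_flat
  by simp

lemma cutoff_exists:
  obtains \<zeta> where "test_function \<zeta>" "\<And>x::real^2. norm x < r \<Longrightarrow> \<zeta> x = 1"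
proof -
  txt \<open>With \<open>f(t) = exp (-1/t)\<close> for \<open>t > 0\<close>, the function \<open>f (exp (-1) - f s)\<close> is constant for
    \<open>s \<le> 0\<close> and vanishes for \<open>s \<ge> 1\<close>; no quotient or integral of smooth functions is needed.\<close>
  define f where "f = flat 1"
  \<comment> \<open>The argument s is |x|^2 - r^2, a polynomial in the coordinates and hence smooth
    also at the origin. The transition takes place where 0 < s < 1.\<close>
  define g where "g x = exp (-1) + (-1) * f (x$1 * x$1 + x$2 * x$2 + (- r\<^sup>2))" for x :: "real^2"
  define \<zeta> where "\<zeta> x = complex_of_real (f (g x)) * (1 / of_real (f (exp (-1))))" for x
  have norm2: "(norm x)\<^sup>2 = x$1 * x$1 + x$2 * x$2" for x :: "real^2"
    by (simp add: power2_norm_eq_inner inner_vec_def sum_2)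
  have "C_k n (\<lambda>x. complex_of_real (x$1 * x$1 + x$2 * x$2 + (- r\<^sup>2)))" for n
    unfolding of_real_add of_real_mult by (intro C_k_add C_k_mult C_k_coord C_k_const)
  from C_k_flat[OF this] have "C_k n (\<lambda>x. complex_of_real (g x))" for n
    unfolding g_def f_def of_real_add of_real_mult by (intro C_k_add C_k_mult C_k_const)
  from C_k_flat[OF this] have smooth: "C_k n \<zeta>" for n
    unfolding \<zeta>_def[abs_def] f_def by (intro C_k_mult C_k_const)
  have "\<zeta> x = 0" if "x \<notin> cball 0 (sqrt (r\<^sup>2 + 1))" for x
  proof -
    have "r\<^sup>2 + 1 < (norm x)\<^sup>2"
      using that power_strict_mono[of "sqrt (r\<^sup>2 + 1)" "norm x" 2] by simp
    then have t: "1 \<le> (norm x)\<^sup>2 + (- r\<^sup>2)" by simp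
    then have "exp (-1) \<le> f ((norm x)\<^sup>2 + (- r\<^sup>2))"
      by (simp add: f_def flat_def)
    then have "g x \<le> 0" by (simp add: g_def norm2)
    then show ?thesis by (simp add: \<zeta>_def f_def flat_def)
  qed
  then have 1: "test_function \<zeta>"
    unfolding test_function_def using smooth by (meson compact_cball)
  have 2: "\<zeta> x = 1" if "norm x < r" for x
  proof -
    have "(norm x)\<^sup>2 + (- r\<^sup>2) \<le> 0"
      using power_mono[of "norm x" r 2] that by simp
    then have "g x = exp (-1)" by (simp add: g_def norm2 f_def flat_def)
    then show ?thesis by (simp add: \<zeta>_def f_def flat_def)
  qed
  show ?thesis using that 1 2 by blast
qed

section \<open>Nonscattering waves are orthogonal to solutions\<close>

lemma integrable_mult_compact_support:
  fixes f \<phi> :: "real^2 \<Rightarrow> complex"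
  assumes f: "loc_integrable f" and \<phi>: "continuous_on UNIV \<phi>"
    and K: "compact K" "\<And>x. x \<notin> K \<Longrightarrow> \<phi> x = 0"
  shows "integrable lebesgue (\<lambda>x. f x * \<phi> x)"
proof -
  have fK: "integrable lebesgue (\<lambda>x. indicator K x *\<^sub>R f x)"
    using f K by (auto simp: loc_integrable_def set_integrable_def)
  have "compact (\<phi> ` K)"
    using \<phi> K by (meson compact_continuous_image continuous_on_subset subset_UNIV)
  then obtain B where B: "\<And>x. x \<in> K \<Longrightarrow> norm (\<phi> x) \<le> B"
    by (metis compact_imp_bounded bounded_iff imageI)
  have "\<phi> \<in> borel_measurable lebesgue"
    using \<phi> by (simp add: borel_measurable_continuous_onI measurable_completion)
  then have "integrable lebesgue (\<lambda>x. (indicator K x *\<^sub>R f x) * \<phi> x)"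
    using fK
  proof (intro Bochner_Integration.integrable_bound[OF integrable_mult_right[OF integrable_norm[OF fK], of B]]
      borel_measurable_times AE_I2)
    fix x
    show "norm (indicator K x *\<^sub>R f x * \<phi> x) \<le> norm (B * norm (indicator K x *\<^sub>R f x))"
      using mult_right_mono[OF order.trans[OF B abs_ge_self], of x "norm (f x)"]
      by (auto simp: norm_mult abs_mult mult.commute split: split_indicator)
  qed auto
  also have "(\<lambda>x. (indicator K x *\<^sub>R f x) * \<phi> x) = (\<lambda>x. f x * \<phi> x)"
    using K by (auto split: split_indicator)
  finally show ?thesis .
qed

lemma test_function_partial_deriv:
  assumes "test_function \<phi>"
  shows "test_function (partial_deriv i \<phi>)"
proof -
  obtain K where K: "compact K" "\<And>x. x \<notin> K \<Longrightarrow> \<phi> x = 0"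
    using assms by (auto simp: test_function_def)
  have "partial_deriv i \<phi> x = 0" if "x \<notin> K" for x
  proof -
    have "partial_deriv i \<phi> x = partial_deriv i (\<lambda>x. 0) x"
      by (rule partial_deriv_cong_open[where S = "- K"])
        (use K that in \<open>auto simp: compact_imp_closed\<close>)
    then show ?thesis by (simp add: partial_deriv_const)
  qed
  moreover have "C_k n (partial_deriv i \<phi>)" for n
    using assms unfolding test_function_def by (meson C_k.simps(2))
  ultimately show ?thesis
    using K(1) by (auto simp: test_function_def)
qed

lemma integrable_mult_test_function:
  assumes "loc_integrable f" "test_function \<phi>"
  shows "integrable lebesgue (\<lambda>x. f x * \<phi> x)"
  using assms integrable_mult_compact_support C_k_imp_continuous unfolding test_function_def by metis

lemma continuous_imp_loc_integrable:
  assumes "continuous_on UNIV f"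
  shows "loc_integrable f"
  unfolding loc_integrable_def set_integrable_def
proof (intro allI impI)
  fix K :: "(real^2) set" assume "compact K"
  then have "integrable lborel (\<lambda>x. indicator K x *\<^sub>R f x)"
    by (intro borel_integrable_compact continuous_on_subset[OF assms]) auto
  then show "integrable lebesgue (\<lambda>x. indicator K x *\<^sub>R f x)"
    by (simp add: integrable_completion)
qed

text \<open>Pair the equation for \<open>u\<close> with \<open>v\<close>. The weak derivatives live
  on the whole plane, across the boundary of \<open>D\<close>, so moving both of them onto
  \<open>v\<close> leaves no boundary terms. What remains is the integral of \<open>u\<close> times
  the Helmholtz operator applied to \<open>v\<close>, which is 0.\<close>

lemma nonscattering_orthogonality:
  assumes "nonscattering k q D w" and "k \<noteq> 0" and "q \<noteq> 1"
    and D: "open D" "bounded D" and w: "continuous_on UNIV w"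
    and v: "\<And>n. C_k n v" "\<And>x. laplacian v x + of_real (k\<^sup>2 * q) * v x = 0"
  shows "(LINT x|lebesgue. indicator D x *\<^sub>R (w x * v x)) = 0"
proof -
  define \<kappa> where "\<kappa> = complex_of_real (k\<^sup>2 * q)"
  define \<beta> where "\<beta> = complex_of_real (k\<^sup>2 * (1 - q))"
  obtain u L where L: "weak_laplacian u L" and u: "AE x in lebesgue. x \<notin> D \<longrightarrow> u x = 0"
    and pde: "AE x in lebesgue. L x + \<kappa> * u x = \<beta> * w x * indicator D x"
    using assms(1) unfolding nonscattering_def \<kappa>_def \<beta>_def by blast
  obtain g h where g: "\<And>i. weak_pderiv i u (g i)" and h: "\<And>i. weak_pderiv i (g i) (h i)"
    and L_eq: "L = (\<lambda>x. \<Sum>i\<in>UNIV. h i x)"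
    using L unfolding weak_laplacian_def by blast
  obtain r where r: "D \<subseteq> ball 0 r"
    using D(2) by (meson bounded_subset_ballD)
  obtain \<zeta> where \<zeta>: "test_function \<zeta>" "\<And>x. norm x < r \<Longrightarrow> \<zeta> x = 1"
    using cutoff_exists[of r] by blast
  \<comment> \<open>A solution \<open>v\<close> need not have compact support. The cutoff turns it
    into a test function without changing it on a ball that contains \<open>D\<close>.\<close>
  define \<phi> where "\<phi> x = \<zeta> x * v x" for x
  have "test_function \<phi>"
    using \<zeta>(1) v(1) unfolding test_function_def \<phi>_def[abs_def]
    by (metis C_k_mult mult_zero_left)
  note test = this test_function_partial_deriv[OF this] test_function_partial_deriv[OF test_function_partial_deriv[OF this]]
  have loc: "loc_integrable u" "loc_integrable (h i)" for i
    using g h unfolding weak_pderiv_def by blast+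
  have \<phi>D: "\<phi> x = v x" if "x \<in> ball 0 r" for x
    using \<zeta>(2)[of x] that by (simp add: \<phi>_def)
  have v_diff: "v differentiable (at x)" "partial_deriv i v differentiable (at x)" for i x
    using v(1)[of 2] by (auto simp: numeral_2_eq_2)
  have p1: "partial_deriv i \<phi> x = partial_deriv i v x" if "x \<in> ball 0 r" for x i
    using partial_deriv_cong_open[OF open_ball that \<phi>D v_diff(1)] .
  have p2: "partial_deriv i (partial_deriv i \<phi>) x = partial_deriv i (partial_deriv i v) x" if "x \<in> ball 0 r" for x i
    using partial_deriv_cong_open[OF open_ball that p1 v_diff(2)] .
  have helm: "laplacian \<phi> x + \<kappa> * \<phi> x = 0" if "x \<in> D" for x
    using v(2)[of x] p2 \<phi>D that r unfolding laplacian_def \<kappa>_def by (simp add: subset_iff)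
  \<comment> \<open>Two weak integrations by parts in each coordinate direction.\<close>
  have "(LINT x|lebesgue. L x * \<phi> x) = (\<Sum>i\<in>UNIV. LINT x|lebesgue. h i x * \<phi> x)"
    unfolding L_eq sum_distrib_right
    by (rule Bochner_Integration.integral_sum) (intro integrable_mult_test_function loc test)
  also have "\<dots> = (\<Sum>i\<in>UNIV. LINT x|lebesgue. u x * partial_deriv i (partial_deriv i \<phi>) x)"
  proof (rule sum.cong[OF refl])
    fix i :: 2
    have "(LINT x|lebesgue. h i x * \<phi> x) = - (LINT x|lebesgue. g i x * partial_deriv i \<phi> x)"
      using h[of i] test unfolding weak_pderiv_def by (metis add.inverse_inverse)
    also have "\<dots> = (LINT x|lebesgue. u x * partial_deriv i (partial_deriv i \<phi>) x)"
      using g[of i] test unfolding weak_pderiv_def by (metis)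
    finally show "(LINT x|lebesgue. h i x * \<phi> x) = \<dots>" .
  qed
  also have "\<dots> = (LINT x|lebesgue. u x * laplacian \<phi> x)"
    unfolding laplacian_def sum_distrib_left
    by (rule Bochner_Integration.integral_sum[symmetric]) (intro integrable_mult_test_function loc test)
  finally have weak: "(LINT x|lebesgue. L x * \<phi> x) = (LINT x|lebesgue. u x * laplacian \<phi> x)" .
  have int_lap: "integrable lebesgue (\<lambda>x. u x * laplacian \<phi> x)"
    unfolding laplacian_def sum_distrib_left
    by (intro Bochner_Integration.integrable_sum integrable_mult_test_function loc test)
  have int_u: "integrable lebesgue (\<lambda>x. \<kappa> * (u x * \<phi> x))"
    by (intro integrable_mult_right integrable_mult_test_function loc test)
  have int_L: "integrable lebesgue (\<lambda>x. L x * \<phi> x)"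
    unfolding L_eq sum_distrib_right
    by (intro Bochner_Integration.integrable_sum integrable_mult_test_function loc test)
  have "(LINT x|lebesgue. \<beta> * (indicator D x *\<^sub>R (w x * v x))) = (LINT x|lebesgue. L x * \<phi> x + \<kappa> * (u x * \<phi> x))"
  proof (rule integral_cong_AE)
    have "integrable lebesgue (\<lambda>x. indicator D x *\<^sub>R (w x * \<phi> x))"
      using integrable_mult_test_function[OF continuous_imp_loc_integrable[OF w] test(1)] D(1)
      by (intro integrable_mult_indicator) auto
    moreover have "(\<lambda>x. indicator D x *\<^sub>R (w x * \<phi> x)) = (\<lambda>x. indicator D x *\<^sub>R (w x * v x))"
      using \<phi>D r by (auto simp: subset_iff split: split_indicator)
    ultimately have "integrable lebesgue (\<lambda>x. indicator D x *\<^sub>R (w x * v x))"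
      by simp
    then show "(\<lambda>x. \<beta> * (indicator D x *\<^sub>R (w x * v x))) \<in> borel_measurable lebesgue"
      by (intro borel_measurable_integrable integrable_mult_right)
    show "(\<lambda>x. L x * \<phi> x + \<kappa> * (u x * \<phi> x)) \<in> borel_measurable lebesgue"
      using int_L int_u by auto
    show "AE x in lebesgue. \<beta> * (indicator D x *\<^sub>R (w x * v x)) = L x * \<phi> x + \<kappa> * (u x * \<phi> x)"
      using pde
    proof eventually_elim
      case (elim x)
      have "L x * \<phi> x + \<kappa> * (u x * \<phi> x) = \<beta> * w x * indicator D x * \<phi> x"
        unfolding elim[symmetric] by (simp add: algebra_simps)
      then show ?case
        using \<phi>D[of x] r by (auto simp: subset_iff split: split_indicator)
    qed
  qed
  also have "\<dots> = (LINT x|lebesgue. u x * laplacian \<phi> x + \<kappa> * (u x * \<phi> x))"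
    using weak int_L int_u int_lap by simp
  \<comment> \<open>\<open>u\<close> vanishes off \<open>D\<close>, and on \<open>D\<close> the test
    function coincides with \<open>v\<close> near each point, so it solves the Helmholtz equation
    there.\<close>
  also have "\<dots> = 0"
  proof (rule integral_eq_zero_AE)
    show "AE x in lebesgue. u x * laplacian \<phi> x + \<kappa> * (u x * \<phi> x) = 0"
      using u
    proof eventually_elim
      case (elim x)
      have "u x * laplacian \<phi> x + \<kappa> * (u x * \<phi> x) = u x * (laplacian \<phi> x + \<kappa> * \<phi> x)"
        by (simp add: algebra_simps)
      then show ?case using elim helm by (cases "x \<in> D") auto
    qed
  qed
  finally have "\<beta> * (LINT x|lebesgue. indicator D x *\<^sub>R (w x * v x)) = 0"
    unfolding Bochner_Integration.integral_mult_right_zero .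
  then show ?thesis
    using assms(2,3) by (simp add: \<beta>_def)
qed

section \<open>The region and its plane wave moments\<close>

lemma Basis_vec2: "(Basis :: (real^2) set) = {axis 1 1, axis 2 1}"
  by (auto simp: Basis_vec_def UNIV_2)

lemma continuous_on_vector2:
  assumes "continuous_on S f" "continuous_on S g"
  shows "continuous_on S (\<lambda>p. vector [f p, g p] :: ('a::real_normed_vector)^2)"
proof -
  have *: "(\<lambda>p. vector [f p, g p] :: 'a^2) = (\<lambda>p. \<chi> i. if i = 1 then f p else g p)"
    by (auto simp: vec_eq_iff forall_2)
  have "continuous_on S (\<lambda>p. if i = 1 then f p else g p)" for i :: 2
    using assms by (cases "i = 1") auto
  then show ?thesis unfolding * by (rule continuous_on_vec_lambda)
qed

text \<open>Lebesgue measure is determined by its values on boxes, and pairing the coordinates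
  carries boxes to boxes of the same area. This is what makes Fubini's theorem available on
  \<open>real^2\<close>.\<close>

lemma lborel_vec2: "lborel = distr (lborel :: (real \<times> real) measure) borel (\<lambda>p. vector [fst p, snd p] :: real^2)"
proof (rule lborel_eqI)
  have m: "(\<lambda>p. vector [fst p, snd p] :: real^2) \<in> borel_measurable lborel"
    by (simp add: borel_measurable_continuous_onI continuous_on_vector2 continuous_intros)
  fix l u :: "real^2"
  assume le: "\<And>b. b \<in> Basis \<Longrightarrow> l \<bullet> b \<le> u \<bullet> b"
  have le': "l $ 1 \<le> u $ 1" "l $ 2 \<le> u $ 2"
    using le[of "axis 1 1"] le[of "axis 2 1"] by (auto simp: Basis_vec2 inner_axis)
  have "(\<lambda>p. vector [fst p, snd p] :: real^2) -` box l u = box (l$1, l$2) (u$1, u$2)"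
    by (auto simp: box_def Basis_vec2 inner_axis Basis_prod_def)
  then have "emeasure (distr (lborel :: (real \<times> real) measure) borel (\<lambda>p. vector [fst p, snd p] :: real^2)) (box l u)
     = emeasure lborel (box (l$1, l$2) (u$1, u$2))"
    using m by (subst emeasure_distr) auto
  also have "\<dots> = ennreal ((u$1 - l$1) * (u$2 - l$2))"
    using le' by (subst emeasure_lborel_box) (auto simp: Basis_prod_def)
  also have "\<dots> = (\<Prod>b\<in>Basis. (u - l) \<bullet> b)"
  proof -
    have "axis 1 1 \<noteq> (axis 2 1 :: real^2)" by (simp add: axis_eq_axis)
    then show ?thesis by (simp add: Basis_vec2 inner_axis)
  qed
  finally show "emeasure (distr (lborel :: (real \<times> real) measure) borel (\<lambda>p. vector [fst p, snd p] :: real^2)) (box l u)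
     = ennreal (\<Prod>b\<in>Basis. (u - l) \<bullet> b)" .
qed simp

lemma integral_lborel_vec2:
  fixes f :: "real^2 \<Rightarrow> complex"
  assumes "integrable lborel f"
  shows "(LINT x|lborel. f x) = (LINT s|lborel. LINT y|lborel. f (vector [s, y]))"
proof -
  have m: "(\<lambda>p. vector [fst p, snd p] :: real^2) \<in> borel_measurable lborel"
    by (simp add: borel_measurable_continuous_onI continuous_on_vector2 continuous_intros)
  have int: "integrable (lborel \<Otimes>\<^sub>M lborel) (\<lambda>p::real \<times> real. f (vector [fst p, snd p]))"
    unfolding lborel_prod by (rule integrable_distr[OF m]) (use assms in \<open>simp add: lborel_vec2[symmetric]\<close>)
  have "(LINT x|lborel. f x) = (LINT p|lborel. f (vector [fst p, snd p]))"
    using m assms by (subst lborel_vec2, subst integral_distr) auto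
  also have "\<dots> = (LINT s|lborel. LINT y|lborel. f (vector [s, y]))"
    using lborel_pair.integral_fst'[OF int] by (simp add: lborel_prod)
  finally show ?thesis .
qed

section \<open>The boundary curve as two graphs over [-3, 3]\<close>

abbreviation curve1 :: "'a::{real_normed_field,banach} \<Rightarrow> 'a" where
  "curve1 t \<equiv> (2 + cos (2 * t)) * cos t"

abbreviation curve2 :: "'a::{real_normed_field,banach} \<Rightarrow> 'a" where
  "curve2 t \<equiv> (2 + cos (2 * t)) * sin t"

definition dcurve1 :: "'a::{real_normed_field,banach} \<Rightarrow> 'a" where
  "dcurve1 t = - 2 * sin (2 * t) * cos t - (2 + cos (2 * t)) * sin t"

lemma DERIV_curve1: "(curve1 has_field_derivative dcurve1 t) (at t within S)"
  unfolding dcurve1_def by (auto intro!: derivative_eq_intros)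

text \<open>The second factor is positive, so the sign of the derivative is that of - sin t, and the
  abscissa is strictly monotone on each half of the parameter interval.\<close>

lemma dcurve1_real: "dcurve1 t = - sin t * (6 * (cos t)\<^sup>2 + 1)" for t :: real
  unfolding dcurve1_def sin_double cos_double_cos by (simp add: power2_eq_square algebra_simps)

lemma curve1_strict_mono: "strict_mono_on {-pi..0::real} curve1"
proof (rule strict_mono_onI)
  fix r s :: real assume rs: "r \<in> {-pi..0}" "s \<in> {-pi..0}" "r < s"
  show "curve1 r < curve1 s"
  proof (rule DERIV_pos_imp_increasing_open[OF rs(3)])
    fix x assume "r < x" "x < s"
    then have "sin (- x) > 0" using rs by (intro sin_gt_zero) auto
    then have "dcurve1 x > 0"
      unfolding dcurve1_real by (intro mult_pos_pos) (auto simp: add_nonneg_pos)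
    then show "\<exists>y. (curve1 has_real_derivative y) (at x) \<and> y > 0"
      using DERIV_curve1 by blast
  qed (intro continuous_intros)
qed

lemma curve1_image: "curve1 ` {-pi..0::real} = {-3..3}"
proof
  show "curve1 ` {-pi..0::real} \<subseteq> {-3..3}"
  proof clarsimp
    fix t :: real
    have "\<bar>2 + cos (2 * t)\<bar> \<le> 3"
      using cos_ge_minus_one[of "2 * t"] cos_le_one[of "2 * t"] by linarith
    then have "\<bar>curve1 t\<bar> \<le> 3 * 1"
      unfolding abs_mult by (rule mult_mono) auto
    then show "- 3 \<le> curve1 t \<and> curve1 t \<le> 3" by (auto simp: abs_le_iff)
  qed
  show "{-3..3} \<subseteq> curve1 ` {-pi..0::real}"
  proof
    fix x :: real assume "x \<in> {-3..3}"
    then have "\<exists>t\<ge>-pi. t \<le> 0 \<and> curve1 t = x"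
      by (intro IVT') (auto intro!: continuous_intros)
    then show "x \<in> curve1 ` {-pi..0}" by auto
  qed
qed

text \<open>The curve is the graph of \<open>\<pm>height\<close> over \<open>[-3, 3]\<close>.\<close>

definition height :: "real \<Rightarrow> real" where
  "height x = - curve2 (the_inv_into {-pi..0} curve1 x)"

lemma the_inv_into_curve1: "t \<in> {-pi..0::real} \<Longrightarrow> the_inv_into {-pi..0} curve1 (curve1 t) = t"
  by (rule the_inv_into_f_f[OF strict_mono_on_imp_inj_on[OF curve1_strict_mono]])

text \<open>Parameters in [-pi, 0] trace the lower half of the curve, where \<open>curve2\<close> is
  at most 0; hence the minus sign.\<close>

lemma height_curve1: "t \<in> {-pi..0} \<Longrightarrow> height (curve1 t) = - curve2 t"
  unfolding height_def by (subst (1 2) the_inv_into_curve1) auto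

lemma height_continuous: "continuous_on {-3..3} height"
proof -
  have "continuous_on (curve1 ` {-pi..0::real}) (the_inv_into {-pi..0} curve1)"
    by (rule continuous_on_inv) (use the_inv_into_curve1 in \<open>auto intro!: continuous_intros\<close>)
  then show ?thesis
    unfolding curve1_image height_def by (intro continuous_intros)
qed

text \<open>Replacing t by -t keeps the first coordinate and negates the second, so the upper half
  is the mirror image of the lower half, which is the graph of - \<open>height\<close>.\<close>

lemma curve_real_range:
  "curve ` {-pi..pi} = {x::real^2. \<bar>x$1\<bar> \<le> 3 \<and> \<bar>x$2\<bar> = height (x$1)}"
proof (intro equalityI subsetI)
  have curve_nth: "curve t $ 1 = curve1 t" "curve t $ 2 = curve2 t" for t :: real
    by (simp_all add: curve_def)
  fix x :: "real^2"
  {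
    assume "x \<in> curve ` {-pi..pi}"
    then obtain t where t: "t \<in> {-pi..pi}" "x = curve t" by auto
    define s where "s = - \<bar>t\<bar>"
    have s: "s \<in> {-pi..0}" using t by (auto simp: s_def)
    have "curve1 s = curve1 t" by (auto simp: s_def abs_if)
    moreover have "curve2 s = - \<bar>curve2 t\<bar>"
    proof -
      have "0 \<le> (2 + cos (2 * \<bar>t\<bar>)) * sin \<bar>t\<bar>"
        using t cos_ge_minus_one[of "2 * \<bar>t\<bar>"] by (intro mult_nonneg_nonneg sin_ge_zero) (auto simp: abs_le_iff simp del: cos_ge_minus_one)
      then show ?thesis by (auto simp: s_def abs_if split: if_splits)
    qed
    ultimately show "x \<in> {x. \<bar>x$1\<bar> \<le> 3 \<and> \<bar>x$2\<bar> = height (x$1)}"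
      using height_curve1[OF s] imageI[OF s, of curve1] unfolding curve1_image
      by (auto simp: t curve_nth abs_le_iff)
  next
    assume "x \<in> {x. \<bar>x$1\<bar> \<le> 3 \<and> \<bar>x$2\<bar> = height (x$1)}"
    then have x: "\<bar>x$1\<bar> \<le> 3" "\<bar>x$2\<bar> = height (x$1)" by auto
    then have "x$1 \<in> curve1 ` {-pi..0}" unfolding curve1_image by auto
    then obtain t where t: "t \<in> {-pi..0}" "x$1 = curve1 t" by auto
    have h: "\<bar>x$2\<bar> = - curve2 t" using x(2) height_curve1[OF t(1)] t(2) by simp
    show "x \<in> curve ` {-pi..pi}"
    proof (cases "x$2 \<ge> 0")
      case True
      then have "x = curve (- t)" using h t by (simp add: vec_eq_iff forall_2 curve_nth)
      then show ?thesis using t(1) by auto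
    next
      case False
      then have "x = curve t" using h t by (simp add: vec_eq_iff forall_2 curve_nth)
      then show ?thesis using t(1) by auto
    qed
  }
qed

text \<open>A ray from \<open>x\<close> that misses \<open>C\<close> lies in the component of
  \<open>x\<close> in the complement of \<open>C\<close>, and that component is then
  unbounded.\<close>

lemma not_inside_ray:
  fixes x d :: "'a::euclidean_space"
  assumes "norm d = 1" and ray: "\<And>s. s \<ge> 0 \<Longrightarrow> x + s *\<^sub>R d \<notin> C"
  shows "x \<notin> inside C"
proof
  let ?T = "(\<lambda>s. x + s *\<^sub>R d) ` {0..}"
  assume "x \<in> inside C"
  moreover have "?T \<subseteq> connected_component_set (- C) x"
  proof (rule connected_component_maximal)
    show "x \<in> ?T" by (rule image_eqI[of _ _ 0]) auto
    show "connected ?T" by (intro connected_continuous_image continuous_intros) auto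
  qed (use ray in auto)
  ultimately have "bounded ?T"
    unfolding inside_def using bounded_subset by blast
  then obtain b where b: "\<And>s. s \<ge> 0 \<Longrightarrow> norm (x + s *\<^sub>R d) \<le> b"
    by (auto simp: bounded_iff)
  \<comment> \<open>Chosen larger than \<open>b + norm x\<close>, which is all that the bound
    \<open>b\<close> on the ray allows.\<close>
  define s where "s = \<bar>b\<bar> + norm x + 1"
  have "s = norm ((x + s *\<^sub>R d) - x)" using assms(1) by (simp add: s_def)
  also have "\<dots> \<le> norm (x + s *\<^sub>R d) + norm x" by (rule norm_triangle_ineq4)
  also have "\<dots> \<le> b + norm x" using b[of s] by (simp add: s_def)
  finally show False by (simp add: s_def)
qed

lemma height_nonneg:
  assumes "x \<in> {-3..3}"
  shows "0 \<le> height x"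
proof -
  obtain t where t: "t \<in> {-pi..0}" "x = curve1 t"
    using assms unfolding curve1_image[symmetric] by auto
  have "0 \<le> (2 + cos (2 * t)) * sin (- t)"
    using t(1) cos_ge_minus_one[of "2 * t"]
    by (intro mult_nonneg_nonneg sin_ge_zero) (auto simp del: cos_ge_minus_one)
  then show ?thesis using height_curve1[OF t(1)] t(2) by simp
qed

lemma height_end: "height 3 = 0" "height (-3) = 0"
  using height_curve1[of 0] height_curve1[of "-pi"] by auto

text \<open>A point outside the domain between the graphs, and not on the curve, escapes to infinity
  along a horizontal or a vertical ray. Conversely, the frontier of that domain lies on the curve,
  so a connected set that starts in the domain and avoids the curve cannot leave it, and the domain
  is bounded.\<close>

lemma region_eq: "region = {x. \<bar>x$1\<bar> < 3 \<and> \<bar>x$2\<bar> < height (x$1)}"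
  unfolding region_def curve_real_range
proof (intro equalityI subsetI)
  let ?C = "{x::real^2. \<bar>x$1\<bar> \<le> 3 \<and> \<bar>x$2\<bar> = height (x$1)}"
  let ?E = "{x::real^2. \<bar>x$1\<bar> < 3 \<and> \<bar>x$2\<bar> < height (x$1)}"
  fix x :: "real^2"
  {
    assume x: "x \<in> inside ?C"
    then have nC: "x \<notin> ?C" by (auto simp: inside_def)
    show "x \<in> ?E"
    proof (rule ccontr)
      assume "x \<notin> ?E"
      have e: "height (x$1) = 0" if "\<bar>x$1\<bar> = 3"
      proof -
        have "x$1 = 3 \<or> x$1 = -3" using that by linarith
        then show ?thesis using height_end by auto
      qed
      consider "\<bar>x$1\<bar> > 3" | "\<bar>x$1\<bar> \<le> 3" "\<bar>x$2\<bar> > height (x$1)"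
      proof (cases "\<bar>x$1\<bar> = 3")
        case True
        then have "\<bar>x$2\<bar> \<noteq> 0" using nC e by auto
        then show ?thesis using that(2) True e by auto
      next
        case False
        then show ?thesis using that nC \<open>x \<notin> ?E\<close> by fastforce
      qed
      then have "x \<notin> inside ?C"
      proof cases
        case 1
        define d :: "real^2" where "d = (if x$1 \<ge> 0 then 1 else -1) *\<^sub>R axis 1 (1::real)"
        have d: "norm d = 1" "d $ 1 = (if x$1 \<ge> 0 then 1 else -1)" by (auto simp: d_def)
        show ?thesis
        proof (rule not_inside_ray[OF d(1)])
          fix s :: real assume "s \<ge> 0"
          then have "\<bar>(x + s *\<^sub>R d) $ 1\<bar> > 3" using 1 by (cases "x$1 \<ge> 0") (auto simp: d(2))
          then show "x + s *\<^sub>R d \<notin> ?C" by simp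
        qed
      next
        case 2
        define d :: "real^2" where "d = (if x$2 \<ge> 0 then 1 else -1) *\<^sub>R axis 2 (1::real)"
        have d: "norm d = 1" "d $ 1 = 0" "d $ 2 = (if x$2 \<ge> 0 then 1 else -1)"
          by (simp_all add: d_def) (simp_all add: axis_def)
        show ?thesis
        proof (rule not_inside_ray[OF d(1)])
          fix s :: real assume "s \<ge> 0"
          then have "\<bar>(x + s *\<^sub>R d) $ 2\<bar> > height ((x + s *\<^sub>R d) $ 1)"
            using 2 by (cases "x$2 \<ge> 0") (auto simp: d(2,3))
          then show "x + s *\<^sub>R d \<notin> ?C" by simp
        qed
      qed
      with x show False by blast
    qed
  next
    assume x: "x \<in> ?E"
    \<comment> \<open>Continuity of \<open>height\<close> is known on [-3, 3] only. \<open>H\<close>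
      continues it by its end values, so that the sets below are visibly open and closed in the
      plane.\<close>
    define H where "H s = height (max (-3) (min 3 s))" for s
    have "continuous_on UNIV H"
      unfolding H_def by (rule continuous_on_compose2[OF height_continuous]) (auto intro!: continuous_intros)
    then have H: "continuous_on UNIV (\<lambda>x::real^2. H (x$1))"
      by (rule continuous_on_compose2) (auto intro!: continuous_intros)
    have H_eq: "H s = height s" if "\<bar>s\<bar> \<le> 3" for s
      using that by (auto simp: H_def min_def max_def)
    let ?E' = "{x::real^2. \<bar>x$1\<bar> < 3} \<inter> {x. \<bar>x$2\<bar> < H (x$1)}"
    let ?F = "{x::real^2. \<bar>x$1\<bar> \<le> 3} \<inter> {x. \<bar>x$2\<bar> \<le> H (x$1)}"
    have E: "?E = ?E'" using H_eq by auto
    have "open ?E'"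
      by (intro open_Int open_Collect_less continuous_intros H)
    moreover have "closed ?F"
      by (intro closed_Int closed_Collect_le continuous_intros H)
    moreover have "?E' \<subseteq> ?F" by auto
    ultimately have "frontier ?E' \<subseteq> ?F - ?E'"
      unfolding frontier_def using interior_open[of ?E'] closure_minimal[of ?E' ?F] by blast
    also have "\<dots> \<subseteq> ?C"
    proof
      fix y assume y: "y \<in> ?F - ?E'"
      show "y \<in> ?C"
      proof (cases "\<bar>y$1\<bar> = 3")
        case True
        then have "y$1 = 3 \<or> y$1 = -3" by linarith
        then have "height (y$1) = 0" using height_end by auto
        then show ?thesis using y H_eq[of "y$1"] True by auto
      next
        case False
        then show ?thesis using y H_eq[of "y$1"] by auto
      qed
    qed
    finally have fr: "frontier ?E \<subseteq> ?C" unfolding E .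
    have "connected_component_set (- ?C) x \<subseteq> ?E"
    proof (rule ccontr)
      assume "\<not> connected_component_set (- ?C) x \<subseteq> ?E"
      then have "connected_component_set (- ?C) x \<inter> frontier ?E \<noteq> {}"
      proof (intro connected_Int_frontier)
        have "x \<in> connected_component_set (- ?C) x" using x by auto
        then show "connected_component_set (- ?C) x \<inter> ?E \<noteq> {}" using x by blast
      qed auto
      then show False using fr connected_component_subset[of "- ?C" x] by blast
    qed
    moreover have "bounded ?E"
    proof -
      have "compact (height ` {-3..3})"
        by (intro compact_continuous_image height_continuous) auto
      then obtain b where b: "\<And>s. s \<in> {-3..3} \<Longrightarrow> \<bar>height s\<bar> \<le> b"
        by (metis compact_imp_bounded bounded_iff imageI real_norm_def)
      have "norm x \<le> 3 + b" if "x \<in> ?E" for x :: "real^2"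
      proof -
        have "\<bar>x$1\<bar> < 3" "\<bar>x$2\<bar> < height (x$1)" using that by auto
        then show ?thesis using norm_le_l1_cart[of x] b[of "x$1"] unfolding sum_2 by force
      qed
      then show ?thesis by (auto simp: bounded_iff)
    qed
    ultimately show "x \<in> inside ?C"
      using x unfolding inside_def by (auto intro: bounded_subset)
  }
qed

lemma curve_image_compact: "compact (curve ` {-pi..pi::real})"
  unfolding curve_def
  by (intro compact_continuous_image continuous_on_vector2 continuous_intros) auto

lemma region_open: "open region"
  unfolding region_def by (simp add: open_inside compact_imp_closed curve_image_compact)

lemma region_bounded: "bounded region"
  unfolding region_def by (simp add: bounded_inside compact_imp_bounded curve_image_compact)

section \<open>Exponential moments of the region as integrals along the curve\<close>

lemma integral_Ioo_eq_Icc: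
  fixes f :: "real \<Rightarrow> complex"
  assumes "f \<in> borel_measurable lborel"
  shows "(LINT x|lborel. indicator {a<..<b} x *\<^sub>R f x) = (LINT x|lborel. indicator {a..b} x *\<^sub>R f x)"
proof (rule integral_cong_AE)
  show "AE x in lborel. indicator {a<..<b} x *\<^sub>R f x = indicator {a..b} x *\<^sub>R f x"
    using AE_lborel_singleton[of a] AE_lborel_singleton[of b]
    by eventually_elim (auto split: split_indicator)
qed (use assms in measurable)

lemma integrable_region_continuous:
  fixes f :: "real^2 \<Rightarrow> complex"
  assumes "continuous_on UNIV f"
  shows "integrable lborel (\<lambda>x. indicator region x *\<^sub>R f x)"
proof -
  have "set_integrable lborel (closure region) f"
    unfolding set_integrable_def
    by (rule borel_integrable_compact) (simp_all add: region_bounded continuous_on_subset[OF assms])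
  then have "set_integrable lborel region f"
    by (rule set_integrable_subset) (simp_all add: region_open closure_subset)
  then show ?thesis by (simp add: set_integrable_def)
qed

text \<open>Integrating in x_2 leaves the values at the two graphs divided by \<open>B\<close>, and
  x_1 = \<open>curve1 t\<close> parametrises both. The minus sign comes from the orientation: the
  curve runs counterclockwise, so its upper half is traversed from right to left.\<close>

lemma integral_region_exp_wave:
  fixes A B :: complex
  assumes "B \<noteq> 0"
  defines "f \<equiv> \<lambda>t. exp (A * curve1 t + B * curve2 t) * dcurve1 t"
  shows "(LINT x|lborel. indicator region x *\<^sub>R exp_wave A B x)
    = - (1 / B) * integral {-pi..pi} (\<lambda>t. f (of_real t))"
proof -
  define G where "G s = (exp (A * of_real s + B * of_real (height s)) - exp (A * of_real s - B * of_real (height s))) / B" for s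
  have G: "continuous_on {-3..3} G"
    unfolding G_def using assms(1) by (intro continuous_intros height_continuous) auto
  have "(LINT x|lborel. indicator region x *\<^sub>R exp_wave A B x)
    = (LINT s|lborel. LINT y|lborel. indicator region (vector [s, y]) *\<^sub>R exp_wave A B (vector [s, y]))"
    by (rule integral_lborel_vec2[OF integrable_region_continuous[OF C_k_imp_continuous[OF C_k_exp_wave]]])
  \<comment> \<open>The open interval comes from the region. The closed one is kept as well because
    \<open>G\<close> is continuous there, which makes the integrand measurable on the whole
    line.\<close>
  also have "\<dots> = (LINT s|lborel. indicator {-3<..<3} s *\<^sub>R (indicator {-3..3} s *\<^sub>R G s))"
  proof (rule Bochner_Integration.integral_cong[OF refl])
    fix s :: real
    show "(LINT y|lborel. indicator region (vector [s, y]) *\<^sub>R exp_wave A B (vector [s, y]))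
      = indicator {-3<..<3} s *\<^sub>R (indicator {-3..3} s *\<^sub>R G s)"
    proof (cases "\<bar>s\<bar> < 3")
      case True
      define h where "h = height s"
      have h: "h \<ge> 0" using height_nonneg[of s] True by (simp add: h_def abs_less_iff)
      have c: "continuous_on X (\<lambda>y. exp (A * of_real s + B * complex_of_real y))" for X
        by (intro continuous_intros)
      have "(LINT y|lborel. indicator region (vector [s, y]) *\<^sub>R exp_wave A B (vector [s, y]))
        = (LINT y|lborel. indicator {-h<..<h} y *\<^sub>R exp (A * of_real s + B * of_real y))"
        using True by (intro Bochner_Integration.integral_cong)
          (auto simp: region_eq exp_wave_def h_def split: split_indicator)
      also have "\<dots> = (LINT y|lborel. indicator {-h..h} y *\<^sub>R exp (A * of_real s + B * of_real y))"
        using c[of UNIV] by (intro integral_Ioo_eq_Icc) (simp add: borel_measurable_continuous_onI)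
      also have "\<dots> = exp (A * of_real s + B * of_real h) / B - exp (A * of_real s + B * of_real (-h)) / B"
      proof (rule integral_FTC_atLeastAtMost)
        fix y
        have "((\<lambda>y. exp (A * of_real s + B * y) / B) has_field_derivative exp (A * of_real s + B * of_real y)) (at (of_real y))"
          using assms(1) by (auto intro!: derivative_eq_intros)
        from has_vector_derivative_real_field[OF this]
        show "((\<lambda>y. exp (A * of_real s + B * of_real y) / B) has_vector_derivative exp (A * of_real s + B * of_real y)) (at y within {-h..h})" .
      qed (use h c in auto)
      also have "\<dots> = G s" by (simp add: G_def h_def diff_divide_distrib)
      finally show ?thesis using True by (simp add: abs_less_iff)
    next
      case False
      then have "vector [s, y] \<notin> region" for y by (auto simp: region_eq)
      then show ?thesis using False by (auto split: split_indicator)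
    qed
  qed
  also have "\<dots> = (LINT s|lborel. indicator {-3..3} s *\<^sub>R (indicator {-3..3} s *\<^sub>R G s))"
    using borel_measurable_continuous_on_indicator[OF _ G] by (intro integral_Ioo_eq_Icc) auto
  also have "\<dots> = (LINT s|lborel. indicator {-3..3} s *\<^sub>R G s)"
    by (intro Bochner_Integration.integral_cong) (auto split: split_indicator)
  also have "\<dots> = integral {-3..3} G"
    using set_borel_integral_eq_integral(2)[OF borel_integrable_atLeastAtMost'[OF G]]
    by (simp add: set_lebesgue_integral_def)
  also have "\<dots> = integral {-pi..0} (\<lambda>t. dcurve1 t *\<^sub>R G (curve1 t))"
  proof -
    have "((\<lambda>t. dcurve1 t *\<^sub>R G (curve1 t)) has_integral integral {curve1 (-pi)..curve1 0} G) {-pi..0}"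
      by (rule has_integral_substitution[OF _ _ equalityD1[OF curve1_image] G DERIV_curve1]) simp_all
    then show ?thesis by (simp add: integral_unique)
  qed
  \<comment> \<open>The value at the upper graph is written through the parameter -t. There
    \<open>curve2\<close> and \<open>dcurve1\<close> change sign while \<open>curve1\<close> does
    not.\<close>
  also have "\<dots> = integral {-pi..0} (\<lambda>t. (- (1 / B)) * f (of_real (- t)) + (- (1 / B)) * f (of_real t))"
  proof (rule integral_cong)
    fix t assume t: "t \<in> {-pi..0::real}"
    have of_real_double: "2 * complex_of_real t = of_real (2 * t)" by simp
    have "f (of_real t) = exp (A * of_real (curve1 t) + B * of_real (curve2 t)) * of_real (dcurve1 t)"
      unfolding f_def dcurve1_def of_real_double sin_of_real cos_of_real by simp
    moreover have "f (of_real (- t)) = exp (A * of_real (curve1 t) - B * of_real (curve2 t)) * - of_real (dcurve1 t)"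
    proof -
      have "2 * complex_of_real (- t) = of_real (- (2 * t))" by simp
      then show ?thesis
        unfolding f_def dcurve1_def \<open>2 * complex_of_real (- t) = _\<close> sin_of_real cos_of_real by simp
    qed
    moreover have "d * ((x - y) / B) = - (1 / B) * (x * - d) + - (1 / B) * (y * d)" for d x y :: complex
      using assms(1) by (simp add: field_simps)
    ultimately show "dcurve1 t *\<^sub>R G (curve1 t) = (- (1 / B)) * f (of_real (- t)) + (- (1 / B)) * f (of_real t)"
      unfolding G_def height_curve1[OF t] by (simp add: scaleR_conv_of_real)
  qed
  also have "\<dots> = - (1 / B) * integral {-pi..pi} (\<lambda>t. f (of_real t))"
  proof -
    have cf: "continuous_on S (\<lambda>t. f (complex_of_real t))" for S
      unfolding f_def dcurve1_def by (intro continuous_intros)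
    have cf': "continuous_on S (\<lambda>t. f (complex_of_real (- t)))" for S
      unfolding f_def dcurve1_def by (intro continuous_intros)
    have "integral {-pi..0} (\<lambda>t. f (of_real (- t))) = integral {0..pi} (\<lambda>t. f (of_real t))"
      using Henstock_Kurzweil_Integration.integral_reflect_real[of pi 0 "\<lambda>t. f (of_real t)"] by simp
    moreover have "integral {-pi..0} (\<lambda>t. f (of_real t)) + integral {0..pi} (\<lambda>t. f (of_real t)) = integral {-pi..pi} (\<lambda>t. f (of_real t))"
      by (rule Henstock_Kurzweil_Integration.integral_combine) (auto intro!: integrable_continuous_real cf)
    moreover have "(\<lambda>t. - (1 / B) * f (of_real (- t))) integrable_on {-pi..0}" "(\<lambda>t. - (1 / B) * f (of_real t)) integrable_on {-pi..0}"
      by (intro integrable_continuous_real continuous_on_mult continuous_on_const cf cf')+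
    note Henstock_Kurzweil_Integration.integral_add[OF this]
    ultimately show ?thesis
      by (simp only: Henstock_Kurzweil_Integration.integral_mult_right distrib_left[symmetric] add.commute)
  qed
  finally show ?thesis .
qed

section \<open>Contour shift and Laplace's method\<close>

text \<open>With a primitive of \<open>f\<close>, the shifted integral is an entire function of the
  shift \<open>s\<close>. Its derivative is the difference of \<open>f\<close> at pi + s and -pi +
  s, which is 0 by periodicity.\<close>

lemma integral_periodic_shift:
  fixes f :: "complex \<Rightarrow> complex"
  assumes hol: "f holomorphic_on UNIV" and per: "\<And>z. f (z + of_real (2 * pi)) = f z"
  shows "integral {-pi..pi} (\<lambda>t. f (of_real t)) = integral {-pi..pi} (\<lambda>t. f (of_real t + s))"
proof -
  obtain \<Phi> where \<Phi>: "\<And>z. (\<Phi> has_field_derivative f z) (at z)"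
    using holomorphic_convex_primitive'[OF convex_UNIV open_UNIV hol] by auto
  define \<Delta> where "\<Delta> s = \<Phi> (of_real pi + s) - \<Phi> (of_real (-pi) + s)" for s
  have int: "integral {-pi..pi} (\<lambda>t. f (of_real t + s)) = \<Delta> s" for s
    unfolding \<Delta>_def
  proof (rule integral_unique, rule fundamental_theorem_of_calculus)
    fix t :: real
    have "((\<lambda>z. \<Phi> (z + s)) has_field_derivative f (of_real t + s)) (at (of_real t))"
      using DERIV_shift[of \<Phi> "f (of_real t + s)" "of_real t" s] \<Phi> by (simp add: add.commute)
    from has_vector_derivative_real_field[OF this]
    show "((\<lambda>t. \<Phi> (of_real t + s)) has_vector_derivative f (of_real t + s)) (at t within {-pi..pi})" .
  qed simp
  have "(\<Delta> has_field_derivative 0) (at z)" for z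
  proof -
    have "((\<lambda>z. \<Phi> (c + z)) has_field_derivative f (c + z)) (at z)" for c
      using DERIV_shift[of \<Phi> "f (c + z)" z c] \<Phi> by (simp add: add.commute)
    then have "(\<Delta> has_field_derivative f (of_real pi + z) - f (of_real (-pi) + z)) (at z)"
      unfolding \<Delta>_def by (intro derivative_intros)
    moreover have "f (of_real pi + z) = f (of_real (-pi) + z)"
      using per[of "of_real (-pi) + z"] by (simp add: algebra_simps)
    ultimately show ?thesis by simp
  qed
  then obtain c where "\<And>z. \<Delta> z = c"
    using has_field_derivative_zero_constant[of UNIV \<Delta>] by auto
  then show ?thesis
    using int[of s] int[of 0] by simp
qed

section \<open>Gaussian integrals and Laplace's method\<close>

lemma gaussian_integrable:
  assumes "b > 0"
  shows "integrable lborel (\<lambda>y::real. exp (- b * y\<^sup>2))"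
proof -
  have "integrable lborel (\<lambda>x::real. exp (- x\<^sup>2))"
  proof -
    have "integrable lborel (normal_density 0 1)" by simp
    then have "integrable lborel (\<lambda>x. normal_density 0 1 (0 + sqrt 2 * x))"
      by (rule lborel_integrable_real_affine) simp
    then have "integrable lborel (\<lambda>x. sqrt (2 * pi) * normal_density 0 1 (0 + sqrt 2 * x))"
      by (rule integrable_mult_right)
    then show ?thesis by (simp add: normal_density_def power_mult_distrib)
  qed
  from lborel_integrable_real_affine[OF this, of "sqrt b" 0] assms
  show ?thesis by (simp add: power_mult_distrib)
qed

lemma gaussian_integral_pos:
  assumes "b > 0"
  shows "(LINT y|lborel. exp (- b * y\<^sup>2)) > (0::real)"
proof -
  have ne: "(LINT y|lborel. exp (- b * y\<^sup>2)) \<noteq> (0::real)"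
  proof
    assume "(LINT y|lborel. exp (- b * y\<^sup>2)) = (0::real)"
    then have "AE y::real in lborel. exp (- b * y\<^sup>2) = 0"
      by (subst (asm) integral_nonneg_eq_0_iff_AE[OF gaussian_integrable[OF assms]]) auto
    then show False by (simp add: eventually_False ae_filter_eq_bot_iff)
  qed
  have "(LINT y|lborel. exp (- b * y\<^sup>2)) \<ge> (0::real)" by (rule integral_nonneg_AE) auto
  with ne show ?thesis by (metis order_le_less)
qed

text \<open>The substitution t = y / sqrt n turns the rescaled integrals into integrals over the
  line dominated by C exp (-b y^2). The rate \<open>b\<close> only has to work on the whole
  interval, while \<open>a\<close> is the exact quadratic coefficient at 0. The bound is a
  conclusion of its own because it will dominate the integrals over all wave directions.\<close>

lemma
  fixes g :: "real \<Rightarrow> complex" and h :: "nat \<Rightarrow> real \<Rightarrow> complex"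
  assumes b: "b > 0" and C: "C \<ge> 0"
    and g: "continuous_on {-c..c} g" and h: "\<And>n. continuous_on {-c..c} (h n)"
    and decay: "\<And>t. t \<in> {-c..c} \<Longrightarrow> Re (g t) \<le> - b * t\<^sup>2"
    and hC: "\<And>n t. t \<in> {-c..c} \<Longrightarrow> n > 0 \<Longrightarrow> norm (h n t) \<le> C"
  shows laplace_bound: "\<And>n. n > 0 \<Longrightarrow> norm (of_real (sqrt n) * integral {-c..c} (\<lambda>t. exp (of_nat n * g t) * h n t))
      \<le> C * (LINT y|lborel. exp (- b * y\<^sup>2))"
    and laplace_limit: "\<lbrakk>c > 0; \<And>t. t \<in> {-c..c} \<Longrightarrow> norm (g t + of_real (a * t\<^sup>2)) \<le> K * \<bar>t\<bar> ^ 3;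
      \<And>y. (\<lambda>n. h n (y / sqrt n)) \<longlonglongrightarrow> h0\<rbrakk> \<Longrightarrow>
      (\<lambda>n. of_real (sqrt n) * integral {-c..c} (\<lambda>t. exp (of_nat n * g t) * h n t))
        \<longlonglongrightarrow> h0 * of_real (LINT y|lborel. exp (- a * y\<^sup>2))"
proof -
  define F where "F n t = indicator {-c..c} t *\<^sub>R (exp (of_nat n * g t) * h n t)" for n t
  have cont: "continuous_on {-c..c} (\<lambda>t. exp (of_nat n * g t) * h n t)" for n
    by (intro continuous_intros g h)
  have F_meas [measurable]: "F n \<in> borel_measurable borel" for n
    unfolding F_def[abs_def] by (rule borel_measurable_continuous_on_indicator[OF _ cont]) simp
  have F_int: "of_real (sqrt n) * integral {-c..c} (\<lambda>t. exp (of_nat n * g t) * h n t) = (LINT y|lborel. F n (y / sqrt n))"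
    if "n > 0" for n
  proof -
    have "integral {-c..c} (\<lambda>t. exp (of_nat n * g t) * h n t) = (LINT t|lborel. F n t)"
      using set_borel_integral_eq_integral(2)[OF borel_integrable_atLeastAtMost'[OF cont]]
      by (simp add: set_lebesgue_integral_def F_def)
    also have "\<dots> = (1 / sqrt n) *\<^sub>R (LINT y|lborel. F n (y / sqrt n))"
      using that by (subst lborel_integral_real_affine[of "1 / sqrt n" _ 0]) auto
    finally show ?thesis using that by (simp add: scaleR_conv_of_real)
  qed
  have F_bound: "norm (F n (y / sqrt n)) \<le> C * exp (- b * y\<^sup>2)" if "n > 0" for n y
  proof (cases "y / sqrt n \<in> {-c..c}")
    case True
    have "real n * Re (g (y / sqrt n)) \<le> real n * (- b * (y / sqrt n)\<^sup>2)"
      by (intro mult_left_mono decay True) auto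
    also have "\<dots> = - b * y\<^sup>2" using that by (simp add: power_divide)
    finally have "exp (real n * Re (g (y / sqrt n))) * norm (h n (y / sqrt n)) \<le> exp (- b * y\<^sup>2) * C"
      using hC[OF True that] by (intro mult_mono) auto
    then show ?thesis using True by (simp add: F_def norm_mult mult.commute)
  qed (use C in \<open>simp add: F_def\<close>)
  have dom: "integrable lborel (\<lambda>y. C * exp (- b * y\<^sup>2))"
    by (intro integrable_mult_right gaussian_integrable b)
  show "norm (of_real (sqrt n) * integral {-c..c} (\<lambda>t. exp (of_nat n * g t) * h n t))
      \<le> C * (LINT y|lborel. exp (- b * y\<^sup>2))" if "n > 0" for n
  proof -
    have "integrable lborel (\<lambda>y. F n (y / sqrt n))"
      by (rule Bochner_Integration.integrable_bound[OF dom])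
        (use F_bound[OF that] C in \<open>auto intro!: AE_I2 simp: abs_mult\<close>)
    then have "norm (LINT y|lborel. F n (y / sqrt n)) \<le> (LINT y|lborel. C * exp (- b * y\<^sup>2))"
      by (intro order.trans[OF integral_norm_bound integral_mono] dom integrable_norm F_bound that)
    then show ?thesis unfolding F_int[OF that] by simp
  qed
  assume c: "c > 0" and quad: "\<And>t. t \<in> {-c..c} \<Longrightarrow> norm (g t + of_real (a * t\<^sup>2)) \<le> K * \<bar>t\<bar> ^ 3"
    and lim: "\<And>y. (\<lambda>n. h n (y / sqrt n)) \<longlonglongrightarrow> h0"
  have ptw: "(\<lambda>n. F n (y / sqrt n)) \<longlonglongrightarrow> h0 * of_real (exp (- a * y\<^sup>2))" for y
  proof -
    have "(\<lambda>n. y / sqrt (real n)) \<longlonglongrightarrow> 0" by real_asymp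
    then have ev: "\<forall>\<^sub>F n in sequentially. y / sqrt n \<in> {-c<..<c}"
      using c by (intro topological_tendstoD) auto
    have "(\<lambda>n. of_nat n * g (y / sqrt n) + of_real (a * y\<^sup>2)) \<longlonglongrightarrow> 0"
    proof (rule Lim_null_comparison)
      \<comment> \<open>The cubic error at y / sqrt n, multiplied by n, is of order 1 / sqrt
        n.\<close>
      show "\<forall>\<^sub>F n in sequentially. norm (of_nat n * g (y / sqrt n) + of_real (a * y\<^sup>2)) \<le> K * \<bar>y\<bar> ^ 3 / sqrt n"
        using ev eventually_gt_at_top[of 0]
      proof eventually_elim
        case (elim n)
        have n: "sqrt (real n) * sqrt (real n) = real n" by simp
        have "of_nat n * g (y / sqrt n) + of_real (a * y\<^sup>2) = of_nat n * (g (y / sqrt n) + of_real (a * (y / sqrt n)\<^sup>2))"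
          using elim by (simp add: power_divide algebra_simps flip: of_real_power of_real_mult)
        then have "norm (of_nat n * g (y / sqrt n) + of_real (a * y\<^sup>2)) = real n * norm (g (y / sqrt n) + of_real (a * (y / sqrt n)\<^sup>2))"
          by (simp add: norm_mult)
        also have "\<dots> \<le> real n * (K * \<bar>y / sqrt n\<bar> ^ 3)"
          using elim by (intro mult_left_mono quad) auto
        also have "\<dots> = K * \<bar>y\<bar> ^ 3 / sqrt n"
          using elim n by (simp add: power_divide power3_eq_cube abs_divide field_simps)
        finally show ?case .
      qed
      show "(\<lambda>n. K * \<bar>y\<bar> ^ 3 / sqrt (real n)) \<longlonglongrightarrow> 0"
      proof -
        have "(\<lambda>n. 1 / sqrt (real n)) \<longlonglongrightarrow> 0" by real_asymp
        from tendsto_mult_right_zero[OF this, of "K * \<bar>y\<bar> ^ 3"] show ?thesis by simp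
      qed
    qed
    then have "(\<lambda>n. (of_nat n * g (y / sqrt n) + of_real (a * y\<^sup>2)) - of_real (a * y\<^sup>2)) \<longlonglongrightarrow> 0 - of_real (a * y\<^sup>2)"
      by (intro tendsto_intros)
    then have "(\<lambda>n. exp (of_nat n * g (y / sqrt n)) * h n (y / sqrt n)) \<longlonglongrightarrow> exp (- of_real (a * y\<^sup>2)) * h0"
      by (intro tendsto_intros lim) simp
    then have "(\<lambda>n. exp (of_nat n * g (y / sqrt n)) * h n (y / sqrt n)) \<longlonglongrightarrow> h0 * of_real (exp (- a * y\<^sup>2))"
      by (simp add: mult.commute exp_of_real[symmetric])
    then show ?thesis
      by (rule Lim_transform_eventually) (use ev in eventually_elim, auto simp: F_def)
  qed
  \<comment> \<open>The index is shifted by one because the Gaussian bound is available for n > 0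
    only; at n = 0 the rescaled variable is a quotient by 0.\<close>
  have "(\<lambda>n. LINT y|lborel. F (Suc n) (y / sqrt (Suc n))) \<longlonglongrightarrow> (LINT y|lborel. h0 * of_real (exp (- a * y\<^sup>2)))"
  proof (rule integral_dominated_convergence[OF _ _ dom])
    show "AE y in lborel. (\<lambda>n. F (Suc n) (y / sqrt (Suc n))) \<longlonglongrightarrow> h0 * of_real (exp (- a * y\<^sup>2))"
      by (rule AE_I2) (rule LIMSEQ_Suc[OF ptw])
    show "AE y in lborel. norm (F (Suc n) (y / sqrt (Suc n))) \<le> C * exp (- b * y\<^sup>2)" for n
      by (rule AE_I2) (rule F_bound, simp)
  qed auto
  also have "(LINT y|lborel. h0 * of_real (exp (- a * y\<^sup>2))) = h0 * of_real (LINT y|lborel. exp (- a * y\<^sup>2))"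
    by (simp only: integral_mult_right_zero integral_complex_of_real)
  finally have "(\<lambda>n. of_real (sqrt (Suc n)) * integral {-c..c} (\<lambda>t. exp (of_nat (Suc n) * g t) * h (Suc n) t)) \<longlonglongrightarrow> h0 * of_real (LINT y|lborel. exp (- a * y\<^sup>2))"
    using F_int by (simp only: zero_less_Suc)
  then show "(\<lambda>n. of_real (sqrt n) * integral {-c..c} (\<lambda>t. exp (of_nat n * g t) * h n t))
        \<longlonglongrightarrow> h0 * of_real (LINT y|lborel. exp (- a * y\<^sup>2))"
    by (rule LIMSEQ_imp_Suc)
qed

section \<open>The saddle point\<close>

definition saddle_im :: real where "saddle_im = ln (2 + sqrt 7) / 2"
text \<open>This is exp (i t_0), and also the modulus of exp (i t) on the whole horizontal line
  through t_0.\<close>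

definition rho :: real where "rho = exp (- saddle_im)"

lemma saddle_im_pos: "saddle_im > 0"
proof -
  have "sqrt 7 > (0::real)" by simp
  then have "1 < 2 + sqrt (7::real)" by linarith
  then show ?thesis unfolding saddle_im_def by simp
qed

lemma rho_pos: "rho > 0" by (simp add: rho_def)

text \<open>This is \<open>z'(t\<^sub>0) = 0\<close>: the linear terms of \<open>phase_eq\<close> below cancel.\<close>

lemma rho_saddle: "2 * rho + 3 * rho ^ 3 / 2 = 1 / (2 * rho)"
proof -
  have "2 + sqrt 7 > (0::real)" by (intro add_pos_nonneg) auto
  then have "rho\<^sup>2 = 1 / (2 + sqrt 7)"
    unfolding rho_def exp_double[symmetric] by (simp add: saddle_im_def exp_minus field_simps)
  also have "\<dots> = (sqrt 7 - 2) / 3"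
    using \<open>2 + sqrt 7 > 0\<close> by (simp add: field_simps)
  finally have r: "rho\<^sup>2 = (sqrt 7 - 2) / 3" .
  \<comment> \<open>The saddle equation multiplied by 2 \<open>rho\<close>: the square of
    \<open>rho\<close> is the positive root of 3 X^2 + 4 X = 1.\<close>
  have "4 * rho\<^sup>2 + 3 * (rho\<^sup>2)\<^sup>2 = 1"
    unfolding r by (simp add: power2_eq_square field_simps)
  then show ?thesis
    using rho_pos by (simp add: field_simps power2_eq_square power3_eq_cube)
qed

definition shifted :: "real \<Rightarrow> complex" where
  "shifted t = of_real t + \<i> * of_real saddle_im"

text \<open>The value of z = x_1 + i x_2 at t_0, where the three exponentials are in phase and their
  positive coefficients add up.\<close>

definition peak :: real where "peak = 2 * rho + rho ^ 3 / 2 + 1 / (2 * rho)"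

definition phase :: "real \<Rightarrow> complex" where
  "phase t = curve1 (shifted t) + \<i> * curve2 (shifted t) - of_real peak"

text \<open>In polar form the point is (2 + cos 2t) exp (i t); expanding the cosine into
  exponentials gives the three frequencies 1, 3 and -1.\<close>

lemma curve_char_coord:
  "curve1 t + \<i> * curve2 t = 2 * exp (\<i> * t) + exp (\<i> * (3 * t)) / 2 + exp (- (\<i> * t)) / 2"
proof -
  have "curve1 t + \<i> * curve2 t = (2 + cos (2 * t)) * exp (\<i> * t)"
    by (simp add: exp_Euler algebra_simps)
  also have "\<dots> = (2 + (exp (\<i> * (2 * t)) + exp (- (\<i> * (2 * t)))) / 2) * exp (\<i> * t)"
    by (simp only: cos_exp_eq)
  also have "\<dots> = 2 * exp (\<i> * t) + exp (\<i> * (2 * t) + \<i> * t) / 2 + exp (- (\<i> * (2 * t)) + \<i> * t) / 2"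
    by (simp only: exp_add) (simp add: algebra_simps add_divide_distrib)
  finally show ?thesis by (simp add: algebra_simps)
qed

lemma phase_eq:
  "phase t = of_real (2 * rho) * (iexp t - 1) + of_real (rho ^ 3 / 2) * (iexp (3 * t) - 1)
    + of_real (1 / (2 * rho)) * (iexp (- t) - 1)"
proof -
  have 1: "exp (\<i> * shifted t) = of_real rho * iexp t"
    by (simp add: shifted_def rho_def algebra_simps exp_add[symmetric] exp_of_real[symmetric])
  have 3: "exp (\<i> * (3 * shifted t)) = of_real (rho ^ 3) * iexp (3 * t)"
  proof -
    have "exp (\<i> * (3 * shifted t)) = exp (of_nat 3 * (\<i> * shifted t))" by (simp add: algebra_simps)
    also have "\<dots> = (of_real rho * iexp t) ^ 3" unfolding exp_of_nat_mult 1 ..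
    also have "\<dots> = of_real (rho ^ 3) * exp (of_nat 3 * (\<i> * of_real t))"
      unfolding exp_of_nat_mult by (simp add: power_mult_distrib)
    finally show ?thesis by (simp add: algebra_simps)
  qed
  have 2: "exp (- (\<i> * shifted t)) = of_real (1 / rho) * iexp (- t)"
    unfolding exp_minus 1 by (simp add: field_simps exp_minus)
  show ?thesis
    unfolding phase_def curve_char_coord 1 2 3 peak_def
    by (simp add: algebra_simps diff_divide_distrib)
qed

section \<open>Decay and quadratic expansion of the phase\<close>

lemma iexp_approx3: "norm (iexp x - (1 + \<i> * of_real x - of_real (x\<^sup>2) / 2)) \<le> \<bar>x\<bar> ^ 3 / 6"
  using iexp_approx1[of x 2]
  by (simp add: numeral_2_eq_2 numeral_3_eq_3 power2_eq_square algebra_simps)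

text \<open>Taylor expansion gives 1 - cos x \<ge> x^2 / 3 for |x| \<le> 2. Using it at x = t / 2 in
  1 - cos t = 2 (1 - cos x) (1 + cos x), where cos x \<ge> 0, covers all |t| \<le> pi.\<close>

lemma one_minus_cos_ge:
  fixes t :: real
  assumes "\<bar>t\<bar> \<le> pi"
  shows "1 - cos t \<ge> t\<^sup>2 / 6"
proof -
  define x where "x = t / 2"
  have x: "\<bar>x\<bar> \<le> 2" "\<bar>x\<bar> \<le> pi / 2" using assms pi_less_4 by (auto simp: x_def)
  have "\<bar>Re (iexp x - (\<Sum>k\<le>3. (\<i> * x) ^ k / fact k))\<bar> \<le> \<bar>x\<bar> ^ 4 / 24"
    using order.trans[OF abs_Re_le_cmod iexp_approx1[of x 3]] by (simp add: fact_numeral)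
  moreover have "Re (iexp x - (\<Sum>k\<le>3. (\<i> * x) ^ k / fact k)) = cos x - 1 + x\<^sup>2 / 2"
    by (simp add: numeral_3_eq_3 Re_exp power2_eq_square)
  moreover have "\<bar>x\<bar> ^ 4 = x\<^sup>2 * x\<^sup>2" by (simp add: power4_eq_xxxx power2_eq_square abs_mult_self_eq mult.assoc)
  moreover have "x\<^sup>2 * x\<^sup>2 \<le> x\<^sup>2 * 4"
    using power_mono[OF x(1), of 2] by (intro mult_left_mono) auto
  ultimately have 1: "1 - cos x \<ge> x\<^sup>2 / 3" by linarith
  have "cos x \<ge> 0" using x(2) by (intro cos_ge_zero) auto
  have "1 - cos t = 2 * ((1 - cos x) * (1 + cos x))"
    using cos_double_cos[of x] by (simp add: x_def power2_eq_square algebra_simps)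
  moreover have "(1 - cos x) * (1 + cos x) \<ge> (x\<^sup>2 / 3) * 1"
    using 1 \<open>cos x \<ge> 0\<close> by (intro mult_mono) auto
  ultimately show ?thesis by (simp add: x_def power_divide)
qed

text \<open>Since all coefficients are positive, the real part is a sum of three nonpositive terms,
  and the first of them alone gives the bound.\<close>

lemma phase_decay:
  assumes "t \<in> {-pi..pi}"
  shows "Re (phase t) \<le> - (rho / 3) * t\<^sup>2"
proof -
  have "Re (phase t) = - (2 * rho * (1 - cos t)) - rho ^ 3 / 2 * (1 - cos (3 * t)) - 1 / (2 * rho) * (1 - cos t)"
    unfolding phase_eq by (simp add: Re_exp algebra_simps diff_divide_distrib)
  also have "\<dots> \<le> - (2 * rho * (1 - cos t))"
  proof -
    have "rho ^ 3 / 2 * (1 - cos (3 * t)) \<ge> 0" "1 / (2 * rho) * (1 - cos t) \<ge> 0"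
      using rho_pos by (intro mult_nonneg_nonneg; simp)+
    then show ?thesis by linarith
  qed
  also have "\<dots> \<le> - (2 * rho * (t\<^sup>2 / 6))"
    using one_minus_cos_ge[of t] assms rho_pos by (auto simp: abs_le_iff)
  finally show ?thesis by simp
qed

text \<open>This is - z''(t_0) / 2: half the sum of the coefficients weighted by the squared
  frequencies 1, 9 and 1.\<close>

definition curvature :: real where "curvature = rho + 9 * rho ^ 3 / 4 + 1 / (4 * rho)"

lemma curvature_pos: "curvature > 0"
  unfolding curvature_def using rho_pos by (intro add_pos_pos) auto

text \<open>Each exponential is expanded to second order. The linear terms cancel by
  \<open>rho_saddle\<close>, the quadratic ones add up to \<open>curvature\<close>, and the
  frequency 3 contributes the factor 27 to the remainder.\<close>

lemma phase_quadratic: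
  "norm (phase t + of_real (curvature * t\<^sup>2)) \<le> (2 * rho + 27 * rho ^ 3 / 2 + 1 / (2 * rho)) / 6 * \<bar>t\<bar> ^ 3"
proof -
  define r where "r x = iexp x - (1 + \<i> * of_real x - of_real (x\<^sup>2) / 2)" for x
  have iexp_r: "iexp x = r x + (1 + \<i> * of_real x - of_real (x\<^sup>2) / 2)" for x by (simp add: r_def)
  have "phase t = of_real (2 * rho) * r t + of_real (rho ^ 3 / 2) * r (3 * t) + of_real (1 / (2 * rho)) * r (- t)
     + \<i> * of_real t * of_real (2 * rho + 3 * rho ^ 3 / 2 - 1 / (2 * rho)) - of_real (curvature * t\<^sup>2)"
    unfolding phase_eq iexp_r curvature_def using rho_pos by (simp add: field_simps power2_eq_square)
  then have "phase t + of_real (curvature * t\<^sup>2) = of_real (2 * rho) * r t + of_real (rho ^ 3 / 2) * r (3 * t) + of_real (1 / (2 * rho)) * r (- t)"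
    using rho_saddle by simp
  also have "norm \<dots> \<le> 2 * rho * (\<bar>t\<bar> ^ 3 / 6) + rho ^ 3 / 2 * (\<bar>3 * t\<bar> ^ 3 / 6) + 1 / (2 * rho) * (\<bar>- t\<bar> ^ 3 / 6)"
  proof (intro order.trans[OF norm_triangle_ineq] add_mono)
    show "norm (of_real (2 * rho) * r t) \<le> 2 * rho * (\<bar>t\<bar> ^ 3 / 6)"
      "norm (of_real (rho ^ 3 / 2) * r (3 * t)) \<le> rho ^ 3 / 2 * (\<bar>3 * t\<bar> ^ 3 / 6)"
      "norm (of_real (1 / (2 * rho)) * r (- t)) \<le> 1 / (2 * rho) * (\<bar>- t\<bar> ^ 3 / 6)"
      unfolding norm_mult norm_of_real r_def using rho_pos
      by (intro mult_mono iexp_approx3; simp)+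
  qed
  also have "\<dots> = (2 * rho + 27 * rho ^ 3 / 2 + 1 / (2 * rho)) / 6 * \<bar>t\<bar> ^ 3"
    by (simp add: abs_mult power_mult_distrib algebra_simps add_divide_distrib)
  finally show ?thesis .
qed

text \<open>Although z' vanishes at t_0, the derivative of x_1 does not, so the leading term of the
  asymptotics survives. On the imaginary axis cosine and sine become cosh and i sinh, which exhibits
  the value as nonzero.\<close>

lemma dcurve1_saddle: "dcurve1 (shifted 0) \<noteq> 0"
proof -
  have "\<i> * shifted 0 = - of_real saddle_im" by (simp add: shifted_def)
  then have "cos (shifted 0) = of_real (cosh saddle_im)" "sin (shifted 0) = \<i> * of_real (sinh saddle_im)"
    by (simp_all add: cos_exp_eq sin_exp_eq cosh_def sinh_def scaleR_conv_of_real field_simps exp_of_real[symmetric])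
  then have "dcurve1 (shifted 0) = - (\<i> * of_real (sinh saddle_im * (6 * (cosh saddle_im)\<^sup>2 + 1)))"
    unfolding dcurve1_def sin_double cos_double_cos by (simp add: power2_eq_square algebra_simps)
  moreover have "sinh saddle_im * (6 * (cosh saddle_im)\<^sup>2 + 1) > 0"
    using saddle_im_pos by (intro mult_pos_pos) (auto simp: add_nonneg_pos)
  ultimately show ?thesis by (metis complex_i_not_zero less_irrefl mult_eq_0_iff neg_equal_0_iff_equal of_real_eq_0_iff)
qed

section \<open>Asymptotics of the moments\<close>

lemma curve_saddle: "curve (shifted 0) = curve (\<i> / 2 * of_real (ln (2 + sqrt 7)))"
  by (simp add: shifted_def saddle_im_def)

lemma continuous_on_shifted:
  "continuous_on S (\<lambda>t. curve1 (shifted t))" "continuous_on S (\<lambda>t. curve2 (shifted t))"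
  "continuous_on S (\<lambda>t. dcurve1 (shifted t))"
  unfolding shifted_def dcurve1_def by (intro continuous_intros)+

text \<open>\<open>test_wave K n\<close> is \<open>exp (n z + \<mu> w)\<close> with \<open>4 n \<mu> = - K\<close>, written in the coordinates
  \<open>x\<^sub>1\<close>, \<open>x\<^sub>2\<close>.\<close>

definition test_mu :: "real \<Rightarrow> nat \<Rightarrow> complex" where
  "test_mu K n = - of_real (K / (4 * real n))"

definition test_wave :: "real \<Rightarrow> nat \<Rightarrow> real^2 \<Rightarrow> complex" where
  "test_wave K n = exp_wave (of_nat n + test_mu K n) (\<i> * (of_nat n - test_mu K n))"

lemma laplacian_test_wave:
  assumes "n > 0"
  shows "laplacian (test_wave K n) x + of_real K * test_wave K n x = 0"
proof -
  have "(of_nat n + test_mu K n)\<^sup>2 + (\<i> * (of_nat n - test_mu K n))\<^sup>2 = 4 * of_nat n * test_mu K n"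
    by (simp add: power2_eq_square algebra_simps)
  also have "\<dots> = - of_real K" using assms by (simp add: test_mu_def field_simps)
  finally show ?thesis by (simp add: test_wave_def laplacian_exp_wave algebra_simps)
qed

text \<open>The factor of the integrand that stays bounded as \<open>n\<close> grows; all
  exponential variation is in exp (n \<open>phase\<close>). The first exponential tends to 1,
  because \<open>test_mu\<close> tends to 0.\<close>

definition amplitude :: "real \<Rightarrow> real \<Rightarrow> real^2 \<Rightarrow> nat \<Rightarrow> real \<Rightarrow> complex" where
  "amplitude k K e n t = exp (test_mu K n * (curve1 (shifted t) - \<i> * curve2 (shifted t)))
     * plane_wave k e (curve (shifted t)) * dcurve1 (shifted t)"

lemma plane_wave_curve:
  "plane_wave k e (curve t) = exp (\<i> * of_real k * (curve1 t * of_real (e $ 1) + curve2 t * of_real (e $ 2)))"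
  by (simp add: plane_wave_def curve_def)

text \<open>A plane wave times a test wave is again an \<open>exp_wave\<close>. Its coefficient
  \<open>B\<close> is i times a real number, which is positive once n > k because the second
  component of \<open>e\<close> is at least -1.\<close>

lemma integral_region_plane_wave:
  assumes "norm e = 1" and "n > 0" and "k > 0" and "real n > k" and "K > 0"
  shows "(LINT x|lborel. indicator region x *\<^sub>R (plane_wave k e (cvec x) * test_wave K n x))
    = - (exp (of_nat n * of_real peak) / (\<i> * (of_nat n - test_mu K n + of_real (k * e $ 2)))) *
      integral {-pi..pi} (\<lambda>t. exp (of_nat n * phase t) * amplitude k K e n t)"
proof -
  define A where "A = of_nat n + test_mu K n + \<i> * of_real (k * e $ 1)"
  define B where "B = \<i> * (of_nat n - test_mu K n + of_real (k * e $ 2))"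
  define f where "f t = exp (A * curve1 t + B * curve2 t) * dcurve1 t" for t
  have "\<bar>e $ 2\<bar> \<le> 1" using component_le_norm_cart[of e 2] assms(1) by simp
  then have "k * e $ 2 \<ge> k * (-1)" using assms(3) by (intro mult_left_mono) auto
  moreover have "K / (4 * real n) \<ge> 0" using assms by simp
  ultimately have "real n + K / (4 * real n) + k * e $ 2 > 0" using assms(4) by linarith
  moreover have "B = \<i> * of_real (real n + K / (4 * real n) + k * e $ 2)"
    by (simp add: B_def test_mu_def)
  ultimately have "B \<noteq> 0" by (simp only: mult_eq_0_iff of_real_eq_0_iff complex_i_not_zero) simp
  have "plane_wave k e (cvec x) * test_wave K n x = exp_wave A B x" for x
    by (simp add: plane_wave_def test_wave_def exp_wave_def cvec_def A_def B_def algebra_simps flip: exp_add)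
  then have "(LINT x|lborel. indicator region x *\<^sub>R (plane_wave k e (cvec x) * test_wave K n x))
      = - (1 / B) * integral {-pi..pi} (\<lambda>t. f (of_real t))"
    using integral_region_exp_wave[OF \<open>B \<noteq> 0\<close>, of A] by (simp add: f_def)
  also have "integral {-pi..pi} (\<lambda>t. f (of_real t)) = integral {-pi..pi} (\<lambda>t. f (of_real t + \<i> * of_real saddle_im))"
  proof (rule integral_periodic_shift)
    show "f holomorphic_on UNIV"
      unfolding f_def dcurve1_def by (intro holomorphic_intros)
    fix z :: complex
    have p: "sin (z + of_real (2 * pi)) = sin z" "cos (z + of_real (2 * pi)) = cos z"
      by (simp_all add: sin_add cos_add flip: sin_of_real cos_of_real)
    have "sin (2 * (z + of_real (2 * pi))) = sin (2 * z)" "cos (2 * (z + of_real (2 * pi))) = cos (2 * z)"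
      unfolding sin_double cos_double_cos p by simp_all
    then show "f (z + of_real (2 * pi)) = f z"
      unfolding f_def dcurve1_def p by simp
  qed
  also have "\<dots> = integral {-pi..pi} (\<lambda>t. exp (of_nat n * of_real peak) * (exp (of_nat n * phase t) * amplitude k K e n t))"
  proof (rule integral_cong)
    fix t
    have "A * curve1 (shifted t) + B * curve2 (shifted t) = of_nat n * of_real peak + of_nat n * phase t
      + test_mu K n * (curve1 (shifted t) - \<i> * curve2 (shifted t))
      + \<i> * of_real k * (curve1 (shifted t) * of_real (e $ 1) + curve2 (shifted t) * of_real (e $ 2))"
      unfolding A_def B_def phase_def by (simp add: algebra_simps)
    then show "f (of_real t + \<i> * of_real saddle_im) = exp (of_nat n * of_real peak) * (exp (of_nat n * phase t) * amplitude k K e n t)"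
      unfolding f_def amplitude_def plane_wave_curve shifted_def[symmetric]
      by (simp only: exp_add mult.assoc)
  qed
  finally show ?thesis by (simp add: B_def)
qed

text \<open>The constant is uniform in the direction \<open>e\<close> as well as in
  \<open>n\<close>, so it serves the dominated convergence in \<open>t\<close> and the one over the
  superposition.\<close>

lemma amplitude_bound:
  assumes "k > 0" "K > 0"
  obtains C where "C \<ge> 0" "\<And>e n t. norm e = 1 \<Longrightarrow> n > 0 \<Longrightarrow> t \<in> {-pi..pi} \<Longrightarrow> norm (amplitude k K e n t) \<le> C"
proof -
  have "\<exists>C. \<forall>t\<in>{-pi..pi}. norm (f t) \<le> C" if "continuous_on {-pi..pi} f" for f :: "real \<Rightarrow> complex"
    using compact_imp_bounded[OF compact_continuous_image[OF that]] by (auto simp: bounded_iff)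
  from this[OF continuous_on_shifted(1)] this[OF continuous_on_shifted(2)] this[OF continuous_on_shifted(3)]
  obtain C1 C2 C3 where C: "\<And>t. t \<in> {-pi..pi} \<Longrightarrow> norm (curve1 (shifted t)) \<le> C1"
     "\<And>t. t \<in> {-pi..pi} \<Longrightarrow> norm (curve2 (shifted t)) \<le> C2"
     "\<And>t. t \<in> {-pi..pi} \<Longrightarrow> norm (dcurve1 (shifted t)) \<le> C3"
    by blast
  have pos: "C1 \<ge> 0" "C2 \<ge> 0" "C3 \<ge> 0"
    using order.trans[OF norm_ge_zero C(1)[of 0]] order.trans[OF norm_ge_zero C(2)[of 0]] order.trans[OF norm_ge_zero C(3)[of 0]] by auto
  have "norm (amplitude k K e n t) \<le> exp (K * (C1 + C2)) * exp (k * (C1 + C2)) * C3"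
    if e: "norm e = 1" and n: "n > 0" and t: "t \<in> {-pi..pi}" for e n t
  proof -
    have mu: "norm (test_mu K n) \<le> K"
    proof -
      have "K / (4 * real n) \<le> K / 1" using n assms by (intro divide_left_mono) auto
      then show ?thesis using assms by (simp add: test_mu_def norm_divide norm_mult)
    qed
    have 1: "norm (test_mu K n * (curve1 (shifted t) - \<i> * curve2 (shifted t))) \<le> K * (C1 + C2)"
      unfolding norm_mult[of "test_mu K n"]
      using order.trans[OF norm_triangle_ineq4 add_mono[OF C(1)[OF t]]] C(2)[OF t] assms mu
      by (intro mult_mono) (auto simp: norm_mult)
    have "\<bar>e $ i\<bar> \<le> 1" for i using component_le_norm_cart[of e i] e by simp
    then have "norm (curve1 (shifted t) * of_real (e $ 1) + curve2 (shifted t) * of_real (e $ 2)) \<le> C1 * 1 + C2 * 1"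
      using C(1,2)[OF t] pos
      by (intro order.trans[OF norm_triangle_ineq add_mono]) (auto simp only: norm_mult norm_of_real intro!: mult_mono)
    then have 2: "norm (\<i> * of_real k * (curve1 (shifted t) * of_real (e $ 1) + curve2 (shifted t) * of_real (e $ 2))) \<le> k * (C1 + C2)"
      using assms by (simp add: norm_mult)
    show ?thesis
      unfolding amplitude_def plane_wave_curve norm_mult
      by (intro mult_mono order.trans[OF norm_exp] C(3) t) (use 1 2 pos in auto)
  qed
  then show ?thesis using that[of "exp (K * (C1 + C2)) * exp (k * (C1 + C2)) * C3"] pos by auto
qed

lemma amplitude_limit:
  "(\<lambda>n. amplitude k K e n (y / sqrt n)) \<longlonglongrightarrow> plane_wave k e (curve (shifted 0)) * dcurve1 (shifted 0)"
proof -
  have y: "(\<lambda>n. y / sqrt (real n)) \<longlonglongrightarrow> 0" by real_asymp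
  have "(\<lambda>n. f (y / sqrt n)) \<longlonglongrightarrow> f 0" if "continuous_on UNIV f" for f :: "real \<Rightarrow> complex"
    using continuous_on_tendsto_compose[OF that y] by simp
  note lim = this[OF continuous_on_shifted(1)] this[OF continuous_on_shifted(2)] this[OF continuous_on_shifted(3)]
  have "(\<lambda>n. K / (4 * real n)) \<longlonglongrightarrow> 0" by real_asymp
  then have "(\<lambda>n. test_mu K n) \<longlonglongrightarrow> - of_real 0"
    unfolding test_mu_def by (intro tendsto_intros)
  then have mu: "(\<lambda>n. test_mu K n) \<longlonglongrightarrow> 0" by simp
  have "(\<lambda>n. amplitude k K e n (y / sqrt n)) \<longlonglongrightarrow>
    exp (0 * (curve1 (shifted 0) - \<i> * curve2 (shifted 0))) * plane_wave k e (curve (shifted 0)) * dcurve1 (shifted 0)"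
    unfolding amplitude_def plane_wave_curve by (intro tendsto_intros lim mu)
  then show ?thesis by simp
qed

lemma continuous_on_plane_wave_cvec:
  "continuous_on UNIV (\<lambda>p. plane_wave k (fst p) (cvec (snd p)))"
  unfolding plane_wave_def cvec_def by (simp, intro continuous_intros)

lemma norm_plane_wave_cvec: "norm (plane_wave k e (cvec x)) = 1"
  by (simp add: plane_wave_def cvec_def norm_exp_eq_Re)

lemma continuous_on_test_wave: "continuous_on S (test_wave K n)"
  unfolding test_wave_def exp_wave_def[abs_def] by (intro continuous_intros)

text \<open>Finite combinations and Herglotz waves are treated together, as integrals over an
  abstract measure \<open>M\<close>. The asymptotics for a single plane wave pass to the
  superposition by Fubini's theorem and dominated convergence.\<close>

lemma superposition_vanishes_at_saddle:
  fixes M :: "'a measure"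
  assumes "sigma_finite_measure M" and e [measurable]: "e \<in> borel_measurable M"
    and e1: "\<And>s. s \<in> space M \<Longrightarrow> norm (e s) = 1" and \<psi>: "integrable M \<psi>"
    and k: "k > 0" and K: "K > 0"
    and U: "U = (\<lambda>z. LINT s|M. \<psi> s * plane_wave k (e s) z)"
    and orth: "\<And>n. n > 0 \<Longrightarrow> (LINT x|lborel. indicator region x *\<^sub>R (U (cvec x) * test_wave K n x)) = 0"
  shows "U (curve (shifted 0)) = 0"
proof -
  interpret M: sigma_finite_measure M by fact
  interpret pair_sigma_finite M lborel ..
  have [measurable]: "\<psi> \<in> borel_measurable M" using \<psi> by auto
  have [measurable]: "region \<in> sets borel" using region_open by simp
  have [measurable]: "test_wave K n \<in> borel_measurable borel" for n
    by (intro borel_measurable_continuous_onI continuous_on_test_wave)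
  have "(\<lambda>p. plane_wave k (fst p) (cvec (snd p))) \<in> borel_measurable (borel \<Otimes>\<^sub>M borel)"
    unfolding borel_prod by (rule borel_measurable_continuous_onI[OF continuous_on_plane_wave_cvec])
  from measurable_compose[OF _ this, of "\<lambda>p. (e (fst p), snd p)" "M \<Otimes>\<^sub>M lborel"]
  have [measurable]: "(\<lambda>p. plane_wave k (e (fst p)) (cvec (snd p))) \<in> borel_measurable (M \<Otimes>\<^sub>M lborel)"
    by simp
  define F where "F n s x = \<psi> s * (indicator region x *\<^sub>R (plane_wave k (e s) (cvec x) * test_wave K n x))" for n s x
  define J where "J n s = integral {-pi..pi} (\<lambda>t. exp (of_nat n * phase t) * amplitude k K (e s) n t)" for n s
  \<comment> \<open>\<open>W\<close> is the moment of one plane wave, rescaled so that it converges.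
    The growth is collected in \<open>E\<close>, which does not depend on \<open>s\<close> and can
    therefore be divided out of the superposition.\<close>
  define W where "W n s = \<psi> s * ((of_nat n / (of_nat n - test_mu K n + of_real (k * e s $ 2))) * (of_real (sqrt n) * J n s))" for n s
  define E where "E n = - (exp (of_nat n * of_real peak) / (\<i> * (of_nat n * of_real (sqrt n))))" for n :: nat
  have F_eq: "(LINT x|lborel. F n s x) = E n * W n s" if "s \<in> space M" "real n > k" for n s
  proof -
    have n: "n > 0" using that(2) k by (cases n) auto
    have "(LINT x|lborel. F n s x) = \<psi> s * (LINT x|lborel. indicator region x *\<^sub>R (plane_wave k (e s) (cvec x) * test_wave K n x))"
      unfolding F_def integral_mult_right_zero ..
    also have "\<dots> = E n * W n s"
    proof -
      have cancel: "p * (- (X / (\<i> * D)) * j) = - (X / (\<i> * (m * r))) * (p * ((m / D) * (r * j)))"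
        if "m \<noteq> 0" "r \<noteq> 0" for m r D X j p :: complex
        using that by (cases "D = 0") (simp_all add: field_simps)
      show ?thesis
        unfolding integral_region_plane_wave[OF e1[OF that(1)] n k that(2) K] J_def[symmetric] E_def W_def
        by (rule cancel) (use n in auto)
    qed
    finally show ?thesis .
  qed
  have F_int: "integrable (M \<Otimes>\<^sub>M lborel) (\<lambda>(s, x). F n s x)" for n
  proof (rule Fubini_integrable)
    show "(\<lambda>(s, x). F n s x) \<in> borel_measurable (M \<Otimes>\<^sub>M lborel)"
      unfolding F_def case_prod_beta by measurable
    \<comment> \<open>At real points a plane wave has modulus 1, so the norm splits into a function
      of \<open>s\<close> times a function of \<open>x\<close>.\<close>
    have nF: "norm (F n s x) = norm (\<psi> s) * norm (indicator region x *\<^sub>R test_wave K n x)" for s x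
      by (simp add: F_def norm_mult norm_plane_wave_cvec)
    show "integrable M (\<lambda>s. LINT x|lborel. norm (case (s, x) of (s, x) \<Rightarrow> F n s x))"
      unfolding prod.case nF integral_mult_right_zero
      by (intro integrable_mult_left integrable_norm \<psi>)
    show "AE s in M. integrable lborel (\<lambda>x. case (s, x) of (s, x) \<Rightarrow> F n s x)"
    proof (rule AE_I2)
      fix s assume "s \<in> space M"
      show "integrable lborel (\<lambda>x. case (s, x) of (s, x) \<Rightarrow> F n s x)"
        unfolding prod.case
      proof (rule Bochner_Integration.integrable_bound)
        show "integrable lborel (\<lambda>x. norm (\<psi> s) * norm (indicator region x *\<^sub>R test_wave K n x))"
          by (intro integrable_mult_right integrable_norm integrable_region_continuous continuous_on_test_wave)
        have "(\<lambda>x. plane_wave k (e s) (cvec x)) \<in> borel_measurable lborel"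
          using continuous_on_compose2[OF continuous_on_plane_wave_cvec, of UNIV "\<lambda>x. (e s, x)"]
          by (simp add: borel_measurable_continuous_onI continuous_intros)
        then show "F n s \<in> borel_measurable lborel"
          unfolding F_def[abs_def] by measurable
      qed (simp add: nF)
    qed
  qed
  have W_zero: "(LINT s|M. W n s) = 0" and W_meas: "W n \<in> borel_measurable M" if n: "real n > k" for n
  proof -
    have n0: "n > 0" using n k by (cases n) auto
    have E0: "E n \<noteq> 0" using n0 by (simp add: E_def)
    \<comment> \<open>Measurability of \<open>W n\<close> in \<open>s\<close> is not apparent from
      its definition; it is inherited from the inner integral in Fubini's theorem.\<close>
    have cong: "W n s = (1 / E n) * (LINT x|lborel. F n s x)" if "s \<in> space M" for s
      using F_eq[OF that n] E0 by simp
    have "integrable M (\<lambda>s. LINT x|lborel. F n s x)"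
      using integrable_fst'[OF F_int[of n]] by simp
    then have "(\<lambda>s. (1 / E n) * (LINT x|lborel. F n s x)) \<in> borel_measurable M" by auto
    then show "W n \<in> borel_measurable M"
      by (subst measurable_cong[OF cong])
    have "0 = (LINT x|lborel. LINT s|M. F n s x)"
    proof -
      have "(LINT s|M. F n s x) = indicator region x *\<^sub>R (U (cvec x) * test_wave K n x)" for x
      proof -
        have "F n s x = (\<psi> s * plane_wave k (e s) (cvec x)) * (indicator region x *\<^sub>R test_wave K n x)" for s
          by (simp add: F_def)
        then have "(LINT s|M. F n s x) = (LINT s|M. \<psi> s * plane_wave k (e s) (cvec x)) * (indicator region x *\<^sub>R test_wave K n x)"
          by (simp only: integral_mult_left_zero)
        then show ?thesis by (simp add: U)
      qed
      then show ?thesis using orth[OF n0] by simp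
    qed
    also have "\<dots> = (LINT s|M. LINT x|lborel. F n s x)"
      by (rule Fubini_integral[OF F_int])
    also have "\<dots> = (LINT s|M. E n * W n s)"
      by (rule Bochner_Integration.integral_cong[OF refl F_eq[OF _ n]])
    also have "\<dots> = E n * (LINT s|M. W n s)" by simp
    finally show "(LINT s|M. W n s) = 0" using E0 by simp
  qed
  obtain C where C: "C \<ge> 0" "\<And>e n t. norm e = 1 \<Longrightarrow> n > 0 \<Longrightarrow> t \<in> {-pi..pi} \<Longrightarrow> norm (amplitude k K e n t) \<le> C"
    using amplitude_bound[OF k K] by blast
  have phase_cont: "continuous_on {-pi..pi} phase"
    unfolding phase_def[abs_def] shifted_def by (intro continuous_intros)
  have amp_cont: "continuous_on {-pi..pi} (amplitude k K e n)" for e n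
    unfolding amplitude_def[abs_def] plane_wave_curve dcurve1_def shifted_def by (intro continuous_intros)
  have rho3: "rho / 3 > 0" using rho_pos by simp
  define G where "G = (LINT y|lborel. exp (- (rho / 3) * y\<^sup>2))"
  define \<Gamma> where "\<Gamma> = (LINT y|lborel. exp (- curvature * y\<^sup>2))"
  have J_bound: "norm (of_real (sqrt n) * J n s) \<le> C * G" if "s \<in> space M" "n > 0" for n s
    unfolding J_def G_def
  proof (rule laplace_bound[where g = phase and h = "amplitude k K (e s)" and b = "rho / 3" and C = C])
    show "norm (amplitude k K (e s) n t) \<le> C" if "t \<in> {-pi..pi}" "n > 0" for n t
      by (rule C(2)[OF e1[OF \<open>s \<in> space M\<close>] that(2,1)])
  qed (fact rho3 C(1) phase_cont amp_cont phase_decay that(2))+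
  have J_limit: "(\<lambda>n. of_real (sqrt n) * J n s) \<longlonglongrightarrow> plane_wave k (e s) (curve (shifted 0)) * dcurve1 (shifted 0) * of_real \<Gamma>"
    if "s \<in> space M" for s
    unfolding J_def \<Gamma>_def
  proof (rule laplace_limit[where g = phase and h = "amplitude k K (e s)" and b = "rho / 3" and C = C])
    show "norm (amplitude k K (e s) n t) \<le> C" if "t \<in> {-pi..pi}" "n > 0" for n t
      by (rule C(2)[OF e1[OF \<open>s \<in> space M\<close>] that(2,1)])
    show "norm (phase t + of_real (curvature * t\<^sup>2)) \<le> (2 * rho + 27 * rho ^ 3 / 2 + 1 / (2 * rho)) / 6 * \<bar>t\<bar> ^ 3" for t
      by (rule phase_quadratic)
  qed (fact rho3 C(1) phase_cont amp_cont phase_decay pi_gt_zero amplitude_limit)+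
  \<comment> \<open>Beyond 2k the denominator in \<open>W\<close> has modulus at least half the
    index, for every direction.\<close>
  obtain N where N: "real N > 2 * k" using reals_Archimedean2 by blast
  have NN: "real (n + N) > 2 * k" "n + N > 0" for n
  proof -
    show "real (n + N) > 2 * k" using N by simp
    then show "n + N > 0" using k by (cases "n + N") auto
  qed
  \<comment> \<open>The factor 1 is the limit of the quotient in \<open>W\<close>. The remaining
    constants are the same for all directions, so the limit is a fixed multiple of \<open>U\<close>
    at the saddle point.\<close>
  have "(\<lambda>n. LINT s|M. W (n + N) s) \<longlonglongrightarrow> (LINT s|M. \<psi> s * (1 * (plane_wave k (e s) (curve (shifted 0)) * dcurve1 (shifted 0) * of_real \<Gamma>)))"
  proof (rule integral_dominated_convergence)
    show "(\<lambda>s. \<psi> s * (1 * (plane_wave k (e s) (curve (shifted 0)) * dcurve1 (shifted 0) * of_real \<Gamma>))) \<in> borel_measurable M"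
    proof -
      have "(\<lambda>\<eta>. plane_wave k \<eta> (curve (shifted 0))) \<in> borel_measurable borel"
        unfolding plane_wave_def by (intro borel_measurable_continuous_onI continuous_intros)
      from measurable_compose[OF e this] show ?thesis by measurable
    qed
    show "W (n + N) \<in> borel_measurable M" for n
      using NN(1)[of n] k by (intro W_meas) auto
    show "integrable M (\<lambda>s. norm (\<psi> s) * (2 * (C * G)))"
      by (intro integrable_mult_left integrable_norm \<psi>)
    have e2: "\<bar>e s $ 2\<bar> \<le> 1" if "s \<in> space M" for s
      using component_le_norm_cart[of "e s" 2] e1[OF that] by simp
    show "AE s in M. norm (W (n + N) s) \<le> norm (\<psi> s) * (2 * (C * G))" for n
    proof (rule AE_I2)
      fix s assume s: "s \<in> space M"
      define m where "m = n + N"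
      have m: "real m > 2 * k" "m > 0" using NN by (auto simp: m_def)
      have "k * e s $ 2 \<ge> k * (-1)" using e2[OF s] k by (intro mult_left_mono) auto
      moreover have "K / (4 * real m) \<ge> 0" using K by simp
      ultimately have D: "real m + K / (4 * real m) + k * e s $ 2 \<ge> real m / 2" using m by linarith
      have "norm (of_nat m - test_mu K m + of_real (k * e s $ 2)) = norm (complex_of_real (real m + K / (4 * real m) + k * e s $ 2))"
        by (simp add: test_mu_def)
      also have "\<dots> \<ge> real m / 2" using D m unfolding norm_of_real by linarith
      finally have "norm (of_nat m / (of_nat m - test_mu K m + of_real (k * e s $ 2))) \<le> real m / (real m / 2)"
        unfolding norm_divide norm_of_nat using m by (intro frac_le) simp_all
      also have "\<dots> = 2" using m by simp
      finally show "norm (W (n + N) s) \<le> norm (\<psi> s) * (2 * (C * G))"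
        unfolding W_def m_def[symmetric] norm_mult[of "\<psi> s"] norm_mult[of "_ / _"]
        by (intro mult_left_mono mult_mono J_bound s m(2)) auto
    qed
    show "AE s in M. (\<lambda>n. W (n + N) s) \<longlonglongrightarrow> \<psi> s * (1 * (plane_wave k (e s) (curve (shifted 0)) * dcurve1 (shifted 0) * of_real \<Gamma>))"
    proof (rule AE_I2)
      fix s assume s: "s \<in> space M"
      have "(\<lambda>n. real n / (real n + K / (4 * real n) + k * e s $ 2)) \<longlonglongrightarrow> 1"
        by real_asymp
      then have "(\<lambda>n. complex_of_real (real n / (real n + K / (4 * real n) + k * e s $ 2))) \<longlonglongrightarrow> of_real 1"
        by (rule tendsto_of_real)
      then have "(\<lambda>n. of_nat n / (of_nat n - test_mu K n + of_real (k * e s $ 2))) \<longlonglongrightarrow> (1 :: complex)"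
        by (simp add: test_mu_def)
      then have "(\<lambda>n. W n s) \<longlonglongrightarrow> \<psi> s * (1 * (plane_wave k (e s) (curve (shifted 0)) * dcurve1 (shifted 0) * of_real \<Gamma>))"
        unfolding W_def by (intro tendsto_mult tendsto_const J_limit s)
      then show "(\<lambda>n. W (n + N) s) \<longlonglongrightarrow> \<psi> s * (1 * (plane_wave k (e s) (curve (shifted 0)) * dcurve1 (shifted 0) * of_real \<Gamma>))"
        by (rule LIMSEQ_ignore_initial_segment)
    qed
  qed
  moreover have "(LINT s|M. W (n + N) s) = 0" for n
    using NN(1)[of n] k by (intro W_zero) auto
  ultimately have "(LINT s|M. \<psi> s * (1 * (plane_wave k (e s) (curve (shifted 0)) * dcurve1 (shifted 0) * of_real \<Gamma>))) = 0"
    by (simp add: LIMSEQ_const_iff)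
  also have "(LINT s|M. \<psi> s * (1 * (plane_wave k (e s) (curve (shifted 0)) * dcurve1 (shifted 0) * of_real \<Gamma>)))
    = (LINT s|M. \<psi> s * plane_wave k (e s) (curve (shifted 0))) * (dcurve1 (shifted 0) * of_real \<Gamma>)"
    by (subst integral_mult_left_zero[symmetric]) (simp add: mult.assoc)
  finally show ?thesis
    using dcurve1_saddle gaussian_integral_pos[OF curvature_pos] by (simp add: U \<Gamma>_def)
qed

section \<open>Incident waves as superpositions, and the conclusion\<close>

lemma finite_measure_restrict_lborel: "finite_measure (restrict_space lborel {-pi..pi::real})"
  by (rule finite_measureI) (simp add: space_restrict_space emeasure_restrict_space)

text \<open>A finite sum is an integral over counting measure, and a Herglotz wave is pulled back
  from the circle to the angle. The square integrable density is integrable because the angle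
  interval has finite measure and a \<le> 1 + a^2.\<close>

lemma wave_superposition:
  assumes "plane_wave_combination k U \<or> herglotz_wave k U"
  obtains (count) S c where "finite S" "\<And>\<eta>. \<eta> \<in> S \<Longrightarrow> norm \<eta> = 1"
      "U = (\<lambda>z. LINT \<eta>|count_space S. c \<eta> * plane_wave k \<eta> z)"
  | (circle) \<psi> where "integrable (restrict_space lborel {-pi..pi}) \<psi>"
      "U = (\<lambda>z. LINT \<theta>|restrict_space lborel {-pi..pi}. \<psi> \<theta> * plane_wave k (vector [cos \<theta>, sin \<theta>]) z)"
  using assms
proof
  assume "plane_wave_combination k U"
  then obtain S c where S: "finite S" "\<forall>\<eta>\<in>S. norm \<eta> = 1" "U = (\<lambda>z. \<Sum>\<eta>\<in>S. c \<eta> * plane_wave k \<eta> z)"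
    unfolding plane_wave_combination_def by blast
  show ?thesis
    by (rule count[of S c]) (use S in \<open>auto simp: lebesgue_integral_count_space_finite\<close>)
next
  assume "herglotz_wave k U"
  then obtain \<psi> where \<psi>: "\<psi> \<in> borel_measurable circle_measure" "integrable circle_measure (\<lambda>\<eta>. (cmod (\<psi> \<eta>))\<^sup>2)"
    and U: "U = (\<lambda>z. LINT \<eta>|circle_measure. \<psi> \<eta> * plane_wave k \<eta> z)"
    unfolding herglotz_wave_def by blast
  let ?M = "restrict_space lborel {-pi..pi::real}"
  let ?e = "\<lambda>\<theta>::real. vector [cos \<theta>, sin \<theta>] :: real^2"
  interpret finite_measure ?M by (rule finite_measure_restrict_lborel)
  have e: "?e \<in> borel_measurable ?M"
    by (intro measurable_restrict_space1)
      (simp add: borel_measurable_continuous_onI continuous_on_vector2 continuous_intros)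
  have \<psi>b: "\<psi> \<in> borel_measurable borel" using \<psi>(1) by (simp add: circle_measure_def cong: measurable_cong_sets)
  have pw: "(\<lambda>\<eta>. plane_wave k \<eta> z) \<in> borel_measurable borel" for z
    unfolding plane_wave_def by (intro borel_measurable_continuous_onI continuous_intros)
  show ?thesis
  proof (rule circle[of "\<lambda>\<theta>. \<psi> (?e \<theta>)"])
    have sq: "integrable ?M (\<lambda>\<theta>. (cmod (\<psi> (?e \<theta>)))\<^sup>2)"
      using \<psi>(2) unfolding circle_measure_def by (rule integrable_distr[OF e])
    show "integrable ?M (\<lambda>\<theta>. \<psi> (?e \<theta>))"
    proof (rule Bochner_Integration.integrable_bound)
      show "integrable ?M (\<lambda>\<theta>. 1 + (cmod (\<psi> (?e \<theta>)))\<^sup>2)"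
        by (intro Bochner_Integration.integrable_add sq) simp
      show "(\<lambda>\<theta>. \<psi> (?e \<theta>)) \<in> borel_measurable ?M"
        by (rule measurable_compose[OF e \<psi>b])
      have "a \<le> 1 + a\<^sup>2" if "a \<ge> 0" for a :: real
        using sum_power2_ge_zero[of "a - 1" 0] that by (simp add: power2_eq_square algebra_simps)
      then show "AE \<theta> in ?M. norm (\<psi> (?e \<theta>)) \<le> norm (1 + (cmod (\<psi> (?e \<theta>)))\<^sup>2)"
        by (auto simp: abs_of_nonneg)
    qed
    show "U = (\<lambda>z. LINT \<theta>|?M. \<psi> (?e \<theta>) * plane_wave k (?e \<theta>) z)"
      unfolding U circle_measure_def
      by (rule ext, rule integral_distr[OF e]) (intro borel_measurable_times \<psi>b pw)
  qed
qed

theorem corollary3p9: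
  fixes k q :: real and U :: "complex^2 \<Rightarrow> complex"
  assumes "k > 0"
    and "0 < q" and "q \<noteq> 1"
    and "plane_wave_combination k U \<or> herglotz_wave k U"
    and "incident_wave k (\<lambda>x. U (cvec x))"
    and "U (curve (\<i> / 2 * of_real (ln (2 + sqrt 7)))) \<noteq> 0"
  shows "scattered k q region (\<lambda>x. U (cvec x))"
  unfolding scattered_def
proof
  assume ns: "nonscattering k q region (\<lambda>x. U (cvec x))"
  have w: "continuous_on UNIV (\<lambda>x. U (cvec x))"
    using assms(5) unfolding incident_wave_def by (meson C_k_imp_continuous)
  have K: "k\<^sup>2 * q > 0" using assms by simp
  have orth: "(LINT x|lborel. indicator region x *\<^sub>R (U (cvec x) * test_wave (k\<^sup>2 * q) n x)) = 0" if "n > 0" for n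
  proof -
    have "(LINT x|lebesgue. indicator region x *\<^sub>R (U (cvec x) * test_wave (k\<^sup>2 * q) n x)) = 0"
    proof (rule nonscattering_orthogonality[OF ns _ assms(3) region_open region_bounded w])
      show "C_k m (test_wave (k\<^sup>2 * q) n)" for m
        by (simp add: test_wave_def C_k_exp_wave)
      show "laplacian (test_wave (k\<^sup>2 * q) n) x + of_real (k\<^sup>2 * q) * test_wave (k\<^sup>2 * q) n x = 0" for x
        by (rule laplacian_test_wave[OF that])
    qed (use assms(1) in auto)
    \<comment> \<open>For a Borel integrand the integral over the completed measure equals the Borel
      one, in which the moments were computed.\<close>
    moreover have "(\<lambda>x. indicator region x *\<^sub>R (U (cvec x) * test_wave (k\<^sup>2 * q) n x)) \<in> borel_measurable lborel"
      using region_open borel_measurable_continuous_onI[OF w]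
        borel_measurable_continuous_onI[OF continuous_on_test_wave]
      by (intro borel_measurable_scaleR borel_measurable_indicator borel_measurable_times) auto
    ultimately show ?thesis by (simp add: integral_completion)
  qed
  from assms(4) have "U (curve (shifted 0)) = 0"
  proof (cases rule: wave_superposition)
    case (count S c)
    show ?thesis
      by (rule superposition_vanishes_at_saddle[of "count_space S" "\<lambda>\<eta>. \<eta>" c k "k\<^sup>2 * q"])
        (use count assms K orth in \<open>auto simp: sigma_finite_measure_count_space_finite integrable_count_space\<close>)
  next
    case (circle \<psi>)
    interpret finite_measure "restrict_space lborel {-pi..pi::real}" by (rule finite_measure_restrict_lborel)
    show ?thesis
    proof (rule superposition_vanishes_at_saddle[OF _ _ _ circle(1) assms(1) K circle(2) orth])
      show "sigma_finite_measure (restrict_space lborel {-pi..pi::real})" by unfold_locales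
      show "(\<lambda>\<theta>. vector [cos \<theta>, sin \<theta>] :: real^2) \<in> borel_measurable (restrict_space lborel {-pi..pi})"
        by (intro measurable_restrict_space1)
          (simp add: borel_measurable_continuous_onI continuous_on_vector2 continuous_intros)
      show "norm (vector [cos \<theta>, sin \<theta>] :: real^2) = 1" for \<theta>
        by (simp add: norm_vec_def L2_set_def sum_2)
    qed
  qed
  then show False using assms(6) by (simp add: curve_saddle)
qed

end
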